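(* Let $G$ be a group acting acylindrically on a hyperbolic space $S$. Then $G$ satisfies exactly one of the following three conditions. (a) $G$ has bounded orbits in $S$. (b) $G$ is virtually cyclic and contains an element that is loxodromic (with respect to the action on $S$). (c) $G$ contains infinitely many (pairwise) independent loxodromic elements.
   Context: All actions on metric spaces are by isometries. A metric space $S$ is hyperbolic if it is geodesic and there is $\delta\ge 0$ such that in every geodesic triangle each side is contained in the union of the $\delta$-neighborhoods of the other two sides. $S$ is non-empty but not assumed proper; $\partial S$ denotes its Gromov boundary (equivalence classes of sequences converging at infinity). An action of $G$ on a metric space $(S,d)$ is acylindrical if for every $\varepsilon>0$ there exist $R,N>0$ such that for every two points $x,y\in S$ with $d(x,y)\ge R$ there are at most $N$ elements $g\in G$ satisfying $d(x,gx)\le\varepsilon$ and $d(y,gy)\le\varepsilon$. An element $g\in G$ is loxodromic if for some (equivalently, any) $s\in S$ the map $\mathbb Z\to S$, $n\mapsto g^ns$, is a quasi-isometric embedding. A loxodromic element $g$ has exactly two limit points $g^{\pm\infty}$ on $\partial S$. Loxodromic elements $g,h$ are independent if $\{g^{\pm\infty}\}\cap\{h^{\pm\infty}\}=\emptyset$. *)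

theory Defs
  imports "HOL-Analysis.Analysis" "HOL-Algebra.Group_Action" "HOL-Algebra.Elementary_Groups"
begin

section \<open>Hyperbolic spaces\<close>

definition geodesic_segment :: "'s::metric_space set \<Rightarrow> 's \<Rightarrow> 's \<Rightarrow> bool" where
  "geodesic_segment A x y \<longleftrightarrow>
     (\<exists>\<gamma>::real \<Rightarrow> 's. \<gamma> 0 = x \<and> \<gamma> (dist x y) = y
        \<and> (\<forall>s\<in>{0..dist x y}. \<forall>t\<in>{0..dist x y}. dist (\<gamma> s) (\<gamma> t) = \<bar>s - t\<bar>)
        \<and> A = \<gamma> ` {0..dist x y})"

definition geodesic_space :: "'s::metric_space itself \<Rightarrow> bool" where
  "geodesic_space _ \<longleftrightarrow> (\<forall>x y :: 's. \<exists>A. geodesic_segment A x y)"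

definition metric_neighborhood :: "real \<Rightarrow> 's::metric_space set \<Rightarrow> 's set" where
  "metric_neighborhood \<delta> A = (\<Union>a\<in>A. cball a \<delta>)"

text \<open>The metric space is the whole type \<open>'s\<close>, which is automatically non-empty.\<close>

definition hyperbolic_space :: "'s::metric_space itself \<Rightarrow> bool" where
  "hyperbolic_space T \<longleftrightarrow> geodesic_space T \<and>
     (\<exists>\<delta>\<ge>0. \<forall>(x::'s) y z A B C.
        geodesic_segment A x y \<and> geodesic_segment B y z \<and> geodesic_segment C z x \<longrightarrow>
          A \<subseteq> metric_neighborhood \<delta> B \<union> metric_neighborhood \<delta> C \<and>
          B \<subseteq> metric_neighborhood \<delta> A \<union> metric_neighborhood \<delta> C \<and>
          C \<subseteq> metric_neighborhood \<delta> A \<union> metric_neighborhood \<delta> B)"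


section \<open>The Gromov boundary\<close>

definition gromov_product :: "'s::metric_space \<Rightarrow> 's \<Rightarrow> 's \<Rightarrow> real" where
  "gromov_product s x y = (dist x s + dist y s - dist x y) / 2"

text \<open>Divergence of Gromov products does not depend on the base point, since changing \<open>s\<close> to
  \<open>s'\<close> changes the product by at most \<open>dist s s'\<close>; hence the harmless quantification over all
  base points.\<close>

definition products_diverge :: "(nat \<Rightarrow> 's::metric_space) \<Rightarrow> (nat \<Rightarrow> 's) \<Rightarrow> bool" where
  "products_diverge x y \<longleftrightarrow>
     (\<forall>s. filterlim (\<lambda>(i, j). gromov_product s (x i) (y j)) at_top
            (sequentially \<times>\<^sub>F sequentially))"

definition converges_at_infinity :: "(nat \<Rightarrow> 's::metric_space) \<Rightarrow> bool" where
  "converges_at_infinity x \<longleftrightarrow> products_diverge x x"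

definition boundary_rel :: "((nat \<Rightarrow> 's::metric_space) \<times> (nat \<Rightarrow> 's)) set" where
  "boundary_rel = {(x, y). converges_at_infinity x \<and> converges_at_infinity y \<and> products_diverge x y}"

definition gromov_boundary :: "(nat \<Rightarrow> 's::metric_space) set set" where
  "gromov_boundary = Collect converges_at_infinity // boundary_rel"

definition converges_to_boundary ::
    "(nat \<Rightarrow> 's::metric_space) \<Rightarrow> (nat \<Rightarrow> 's) set \<Rightarrow> bool" where
  "converges_to_boundary x \<xi> \<longleftrightarrow> \<xi> \<in> gromov_boundary \<and> x \<in> \<xi>"


section \<open>Group actions\<close>

definition isometric_action ::
    "('g, 'm) monoid_scheme \<Rightarrow> ('g \<Rightarrow> 's::metric_space \<Rightarrow> 's) \<Rightarrow> bool" where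
  "isometric_action G \<phi> \<longleftrightarrow> group_action G UNIV \<phi> \<and>
     (\<forall>g\<in>carrier G. \<forall>x y. dist (\<phi> g x) (\<phi> g y) = dist x y)"

definition acylindrical_action ::
    "('g, 'm) monoid_scheme \<Rightarrow> ('g \<Rightarrow> 's::metric_space \<Rightarrow> 's) \<Rightarrow> bool" where
  "acylindrical_action G \<phi> \<longleftrightarrow> isometric_action G \<phi> \<and>
     (\<forall>\<epsilon>>0. \<exists>R>0. \<exists>N::nat. N > 0 \<and>
        (\<forall>x y. dist x y \<ge> R \<longrightarrow>
           finite {g \<in> carrier G. dist x (\<phi> g x) \<le> \<epsilon> \<and> dist y (\<phi> g y) \<le> \<epsilon>} \<and>
           card {g \<in> carrier G. dist x (\<phi> g x) \<le> \<epsilon> \<and> dist y (\<phi> g y) \<le> \<epsilon>} \<le> N))"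

definition bounded_orbits ::
    "('g, 'm) monoid_scheme \<Rightarrow> ('g \<Rightarrow> 's::metric_space \<Rightarrow> 's) \<Rightarrow> bool" where
  "bounded_orbits G \<phi> \<longleftrightarrow> (\<forall>s. bounded (orbit G \<phi> s))"

text \<open>The metric of the source is an explicit argument because \<open>int\<close> is not an instance of
  \<open>metric_space\<close>.\<close>

definition quasi_isometric_embedding ::
    "('a \<Rightarrow> 'a \<Rightarrow> real) \<Rightarrow> ('a \<Rightarrow> 'b::metric_space) \<Rightarrow> bool" where
  "quasi_isometric_embedding d f \<longleftrightarrow>
     (\<exists>K\<ge>1. \<exists>C\<ge>0. \<forall>x y.
        d x y / K - C \<le> dist (f x) (f y) \<and> dist (f x) (f y) \<le> K * d x y + C)"

definition loxodromic ::
    "('g, 'm) monoid_scheme \<Rightarrow> ('g \<Rightarrow> 's::metric_space \<Rightarrow> 's) \<Rightarrow> 'g \<Rightarrow> bool" where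
  "loxodromic G \<phi> g \<longleftrightarrow> g \<in> carrier G \<and>
     (\<exists>s. quasi_isometric_embedding (\<lambda>m n. real_of_int \<bar>m - n\<bar>)
            (\<lambda>n::int. \<phi> (g [^]\<^bsub>G\<^esub> n) s))"

text \<open>The points of the boundary at which the orbits of the cyclic group generated by \<open>g\<close>
  accumulate. For loxodromic \<open>g\<close> this is the set consisting of the two points \<open>g\<^sup>+\<^sup>\<infinity>\<close>
  and \<open>g\<^sup>-\<^sup>\<infinity>\<close>.\<close>

definition limit_points ::
    "('g, 'm) monoid_scheme \<Rightarrow> ('g \<Rightarrow> 's::metric_space \<Rightarrow> 's) \<Rightarrow> 'g \<Rightarrow> (nat \<Rightarrow> 's) set set" where
  "limit_points G \<phi> g =
     {\<xi>. \<exists>s (k::nat \<Rightarrow> int). converges_to_boundary (\<lambda>n. \<phi> (g [^]\<^bsub>G\<^esub> k n) s) \<xi>}"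

definition independent_loxodromics ::
    "('g, 'm) monoid_scheme \<Rightarrow> ('g \<Rightarrow> 's::metric_space \<Rightarrow> 's) \<Rightarrow> 'g \<Rightarrow> 'g \<Rightarrow> bool" where
  "independent_loxodromics G \<phi> g h \<longleftrightarrow>
     loxodromic G \<phi> g \<and> loxodromic G \<phi> h \<and> limit_points G \<phi> g \<inter> limit_points G \<phi> h = {}"

definition virtually_cyclic :: "('g, 'm) monoid_scheme \<Rightarrow> bool" where
  "virtually_cyclic G \<longleftrightarrow>
     (\<exists>H. subgroup H G \<and> cyclic_group (G\<lparr>carrier := H\<rparr>) \<and> finite (rcosets\<^bsub>G\<^esub> H))"

end

theory Submission
  imports Defs "HOL-Real_Asymp.Real_Asymp"
begin

text \<open>Everything is derived from the Gromov inequality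
  \<open>(x|z)\<^sub>w \<ge> min (x|y)\<^sub>w (y|z)\<^sub>w - \<delta>\<close> and the local-to-global principle for discrete paths
  that it implies.

  If no element is loxodromic but some orbit is unbounded, then any two far orbit points lie in
  nearly the same direction from the base point. Hence finitely many given elements all move two
  far apart points on a sufficiently long geodesic by a uniformly bounded amount, which
  contradicts acylindricity.

  If two loxodromic elements \<open>g\<close>, \<open>h\<close> share a limit point, then \<open>g\<^sup>i x\<close> stays
  uniformly close to some \<open>h\<^sup>j x\<close>; acylindricity leaves only finitely many possibilities
  for \<open>h\<^sup>-\<^sup>j g\<^sup>i\<close>, so \<open>g\<close> and \<open>h\<close> have a common non-trivial power.
  The same argument shows that \<open>\<langle>g\<rangle>\<close> has finite index in its commensurator. If this is all of
  \<open>G\<close>, then \<open>G\<close> is virtually cyclic; otherwise \<open>g\<close> has a conjugate \<open>h\<close> without a common power,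
  and the conjugates of \<open>h\<close> by the powers of \<open>g\<close> are pairwise independent.\<close>

section \<open>Gromov products\<close>

lemma gromov_product_commute: "gromov_product s x y = gromov_product s y x"
  by (simp add: gromov_product_def dist_commute)

lemma gromov_product_double: "2 * gromov_product s x y = dist s x + dist s y - dist x y"
  by (simp add: gromov_product_def dist_commute)

lemma gromov_product_le_dist: "gromov_product s x y \<le> dist s x"
  using dist_triangle[of y s x] by (simp add: gromov_product_def dist_commute)

lemma gromov_product_add: "gromov_product s x y + gromov_product x s y = dist s x"
  by (simp add: gromov_product_def dist_commute field_simps)

lemma gromov_product_perturb:
  "gromov_product s x y \<le> gromov_product s' x' y' + dist s s' + dist x x' + dist y y'"
proof -
  have "dist x s \<le> dist x x' + dist x' s' + dist s s'"
    "dist y s \<le> dist y y' + dist y' s' + dist s s'"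
    "dist x' y' \<le> dist x x' + dist x y + dist y y'"
    by metric+
  then show ?thesis unfolding gromov_product_def by argo
qed

lemma gromov_product_base_change: "gromov_product s x y \<le> gromov_product s' x y + dist s s'"
  using gromov_product_perturb[of s x y s' x y] by simp

lemma gromov_product_near: "dist s x - dist x y \<le> gromov_product s x y"
  using dist_triangle[of s x y] by (simp add: gromov_product_def dist_commute)

section \<open>Geodesic segments and slim triangles\<close>

lemma geodesic_segment_dist:
  assumes "geodesic_segment A x y" "p \<in> A"
  shows "dist x p + dist p y = dist x y"
proof -
  obtain \<gamma> where g: "\<gamma> 0 = x" "\<gamma> (dist x y) = y"
    "\<forall>s\<in>{0..dist x y}. \<forall>t\<in>{0..dist x y}. dist (\<gamma> s) (\<gamma> t) = \<bar>s - t\<bar>"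
    "A = \<gamma> ` {0..dist x y}"
    using assms(1) unfolding geodesic_segment_def by blast
  then obtain t where t: "t \<in> {0..dist x y}" "p = \<gamma> t" using assms(2) by blast
  have "dist (\<gamma> 0) (\<gamma> t) = \<bar>0 - t\<bar>" "dist (\<gamma> t) (\<gamma> (dist x y)) = \<bar>t - dist x y\<bar>"
    using g(3) t(1) by simp_all
  then show ?thesis using g t by auto
qed

lemma geodesic_segment_gromov_product_le:
  assumes "geodesic_segment A x y" "p \<in> A"
  shows "gromov_product w x y \<le> dist w p"
  using geodesic_segment_dist[OF assms] dist_triangle[of x w p] dist_triangle[of y w p]
  by (simp add: gromov_product_def dist_commute)

lemma geodesic_segment_ends:
  assumes "geodesic_segment A x y"
  shows "x \<in> A" "y \<in> A"
proof -
  obtain \<gamma> where "\<gamma> 0 = x" "\<gamma> (dist x y) = y" "A = \<gamma> ` {0..dist x y}"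
    using assms unfolding geodesic_segment_def by blast
  moreover have "0 \<in> {0..dist x y}" "dist x y \<in> {0..dist x y}" by simp_all
  ultimately show "x \<in> A" "y \<in> A" by (metis imageI)+
qed

lemma geodesic_space_point_at:
  fixes x y :: "'s::metric_space"
  assumes "geodesic_space TYPE('s)" "0 \<le> t" "t \<le> dist x y"
  obtains z where "dist x z = t" "dist z y = dist x y - t"
proof -
  obtain A where A: "geodesic_segment A x y" using assms(1) unfolding geodesic_space_def by blast
  then obtain \<gamma> where g: "\<gamma> 0 = x" "\<gamma> (dist x y) = y"
    "\<forall>s\<in>{0..dist x y}. \<forall>t\<in>{0..dist x y}. dist (\<gamma> s) (\<gamma> t) = \<bar>s - t\<bar>"
    "A = \<gamma> ` {0..dist x y}"
    unfolding geodesic_segment_def by blast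
  have "dist (\<gamma> 0) (\<gamma> t) = \<bar>0 - t\<bar>" using g(3) assms by simp
  moreover have "\<gamma> t \<in> A" using g(4) assms by simp
  ultimately have "dist x (\<gamma> t) = t" "dist (\<gamma> t) y = dist x y - t"
    using geodesic_segment_dist[OF A, of "\<gamma> t"] g(1) assms(2) by simp_all
  then show ?thesis using that by blast
qed

lemma geodesic_segment_commute:
  assumes "geodesic_segment A x y"
  shows "geodesic_segment A y x"
proof -
  obtain \<gamma> where g: "\<gamma> 0 = x" "\<gamma> (dist x y) = y"
    "\<forall>s\<in>{0..dist x y}. \<forall>t\<in>{0..dist x y}. dist (\<gamma> s) (\<gamma> t) = \<bar>s - t\<bar>"
    "A = \<gamma> ` {0..dist x y}"
    using assms unfolding geodesic_segment_def by blast
  define \<eta> where "\<eta> t = \<gamma> (dist x y - t)" for t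
  have "A = \<eta> ` {0..dist y x}"
  proof -
    have "(\<lambda>t. dist x y - t) ` {0..dist x y} = {0..dist x y}"
      by (auto simp: image_iff intro!: bexI[of _ "dist x y - _"])
    then have "\<gamma> ` {0..dist x y} = \<gamma> ` (\<lambda>t. dist x y - t) ` {0..dist x y}" by simp
    then show ?thesis using g(4) unfolding \<eta>_def image_image by (simp only: dist_commute)
  qed
  moreover have "\<eta> 0 = y" "\<eta> (dist y x) = x" using g by (simp_all add: \<eta>_def dist_commute)
  moreover have "\<forall>s\<in>{0..dist y x}. \<forall>t\<in>{0..dist y x}. dist (\<eta> s) (\<eta> t) = \<bar>s - t\<bar>"
    using g(3) by (auto simp: \<eta>_def dist_commute)
  ultimately show ?thesis unfolding geodesic_segment_def by blast
qed

text \<open>The side \<open>A\<close> is connected and covered by the closed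
  \<open>d\<close>-neighborhoods of \<open>B\<close> and \<open>C\<close>, each of which meets it,
  so some \<open>p\<close> on \<open>A\<close> is near both. Adding the triangle inequalities
  through nearby points of \<open>B\<close> and \<open>C\<close> bounds
  \<open>dist w p\<close>.\<close>

lemma slim_triangle_center:
  fixes w x z :: "'s::metric_space"
  assumes A: "geodesic_segment A x z" and B: "geodesic_segment B w x" and C: "geodesic_segment C w z"
    and cover: "A \<subseteq> metric_neighborhood d B \<union> metric_neighborhood d C" and "0 \<le> d"
  obtains p where "p \<in> A" "dist w p \<le> gromov_product w x z + 2 * d + 2"
proof -
  obtain \<gamma> where g: "\<gamma> 0 = x" "\<gamma> (dist x z) = z"
    "\<forall>s\<in>{0..dist x z}. \<forall>t\<in>{0..dist x z}. dist (\<gamma> s) (\<gamma> t) = \<bar>s - t\<bar>"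
    "A = \<gamma> ` {0..dist x z}"
    using A unfolding geodesic_segment_def by blast
  have "continuous_on {0..dist x z} \<gamma>"
    unfolding continuous_on_iff
  proof (intro ballI allI impI)
    fix s e :: real assume "s \<in> {0..dist x z}" "e > 0"
    then show "\<exists>da>0. \<forall>t\<in>{0..dist x z}. dist t s < da \<longrightarrow> dist (\<gamma> t) (\<gamma> s) < e"
      using g(3) by (intro exI[of _ e]) (auto simp: dist_real_def)
  qed
  then have connA: "connected A" using g(4) by (simp add: connected_continuous_image)
  have ne: "B \<noteq> {}" "C \<noteq> {}" using geodesic_segment_ends B C by blast+
  let ?U = "{p. infdist p B \<le> d}" and ?V = "{p. infdist p C \<le> d}"
  have cl: "closed ?U" "closed ?V"
    by (intro closed_Collect_le continuous_intros)+
  have sub: "A \<subseteq> ?U \<union> ?V"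
    using cover by (force simp: metric_neighborhood_def dist_commute intro: infdist_le2)
  have "x \<in> A \<inter> ?U" "z \<in> A \<inter> ?V"
    using geodesic_segment_ends[OF A] geodesic_segment_ends[OF B] geodesic_segment_ends[OF C] \<open>0 \<le> d\<close>
    by (auto simp: infdist_zero)
  then have "A \<inter> ?U \<inter> ?V \<noteq> {}"
    using connA cl sub unfolding connected_closed by blast
  then obtain p where p: "p \<in> A" "infdist p B \<le> d" "infdist p C \<le> d" by blast
  \<comment> \<open>The slack 1 avoids showing that the infima are attained.\<close>
  have "\<exists>b\<in>B. dist p b < d + 1" "\<exists>c\<in>C. dist p c < d + 1"
    using p ne infdist_attains_inf cInf_lessD[of "dist p ` B" "d + 1"] cInf_lessD[of "dist p ` C" "d + 1"]
    by (auto simp: infdist_def)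
  then obtain b c where bc: "b \<in> B" "dist p b < d + 1" "c \<in> C" "dist p c < d + 1" by blast
  have "dist x p + dist p z = dist x z" "dist w b + dist b x = dist w x" "dist w c + dist c z = dist w z"
    using geodesic_segment_dist A B C p bc by blast+
  moreover have "dist w p \<le> dist w b + dist p b" "dist x p \<le> dist b x + dist p b"
    "dist w p \<le> dist w c + dist p c" "dist p z \<le> dist c z + dist p c"
    by metric+
  ultimately have "dist w p \<le> gromov_product w x z + 2 * d + 2"
    using bc unfolding gromov_product_def by (simp only: dist_commute) argo
  then show ?thesis using that p by blast
qed

locale gromov_hyperbolic =
  fixes X :: "'s::metric_space itself" and \<delta> :: real
  assumes gromov_ineq:
    "min (gromov_product w x y) (gromov_product w y z) - \<delta> \<le> gromov_product w x (z :: 's)"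

text \<open>Slimness moves the point of \<open>slim_triangle_center\<close> on a side from
  \<open>x\<close> to \<open>z\<close> by at most \<open>d\<close> onto one of the other two sides,
  whose points are at least as far from \<open>w\<close> as the Gromov product of their ends. The
  constant \<open>3 * d + 2\<close> adds the two errors.\<close>

lemma hyperbolic_space_gromov_hyperbolic:
  assumes "hyperbolic_space TYPE('s::metric_space)"
  shows "\<exists>\<delta>. gromov_hyperbolic TYPE('s) \<delta>"
proof -
  obtain d where "d \<ge> 0" and geo: "geodesic_space TYPE('s)" and
    slim: "\<And>(x::'s) y z A B C.
        geodesic_segment A x y \<Longrightarrow> geodesic_segment B y z \<Longrightarrow> geodesic_segment C z x \<Longrightarrow>
          A \<subseteq> metric_neighborhood d B \<union> metric_neighborhood d C"
    using assms unfolding hyperbolic_space_def by metis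
  have "min (gromov_product w x y) (gromov_product w y z) - (3 * d + 2) \<le> gromov_product w x z"
    for w x y z :: 's
  proof -
    obtain A B C D E where
      A: "geodesic_segment A x z" and B: "geodesic_segment B w x" and C: "geodesic_segment C w z"
      and D: "geodesic_segment D x y" and E: "geodesic_segment E y z"
      using geo unfolding geodesic_space_def by metis
    have "A \<subseteq> metric_neighborhood d C \<union> metric_neighborhood d B"
      using slim[OF A geodesic_segment_commute[OF C] B] .
    then obtain p where p: "p \<in> A" "dist w p \<le> gromov_product w x z + 2 * d + 2"
      using slim_triangle_center[OF A B C _ \<open>d \<ge> 0\<close>] by (auto simp: Un_commute)
    have "A \<subseteq> metric_neighborhood d E \<union> metric_neighborhood d D"
      using slim[OF A geodesic_segment_commute[OF E] geodesic_segment_commute[OF D]] .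
    then obtain q where q: "q \<in> D \<union> E" "dist p q \<le> d"
      using p(1) by (force simp: metric_neighborhood_def dist_commute)
    then have "min (gromov_product w x y) (gromov_product w y z) \<le> dist w q"
      using geodesic_segment_gromov_product_le[OF D] geodesic_segment_gromov_product_le[OF E]
      by (auto simp: min_le_iff_disj)
    also have "dist w q \<le> dist w p + dist p q" by (rule dist_triangle)
    finally show ?thesis using p q by linarith
  qed
  then show ?thesis by (auto simp: gromov_hyperbolic_def)
qed

lemma discrete_intermediate_value:
  fixes f :: "nat \<Rightarrow> real"
  assumes "f 0 \<le> T" "T \<le> f n" "\<And>i. \<bar>f (Suc i) - f i\<bar> \<le> s"
  shows "\<exists>i\<le>n. \<bar>f i - T\<bar> \<le> s"
  using assms(2)
proof (induction n)
  case 0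
  have "0 \<le> s" using assms(3)[of 0] by linarith
  then show ?case using 0 assms(1) by auto
next
  case (Suc n)
  show ?case
  proof (cases "T \<le> f n")
    case True
    then show ?thesis using Suc.IH le_Suc_eq by blast
  next
    case False
    then have "\<bar>f (Suc n) - T\<bar> \<le> s" using Suc.prems assms(3)[of n] by linarith
    then show ?thesis by blast
  qed
qed

section \<open>Discrete quasi-geodesics\<close>

context gromov_hyperbolic
begin

lemma delta_nonneg: "0 \<le> \<delta>"
  using gromov_ineq[of undefined undefined undefined undefined] by simp

lemma gromov_ineq_cases:
  fixes w x y z :: 's
  obtains "gromov_product w x y \<le> gromov_product w x z + \<delta>"
    | "gromov_product w y z \<le> gromov_product w x z + \<delta>"
  using gromov_ineq[of w x y z] by linarith

text \<open>Expanding the products at base point \<open>z\<close> turns the Gromov inequality into a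
  statement about the three sums of opposite distances, in which no point is distinguished.\<close>

lemma four_point:
  fixes x y z w :: 's
  shows "dist x y + dist z w \<le> max (dist x z + dist y w) (dist x w + dist y z) + 2 * \<delta>"
proof -
  consider "gromov_product z x w \<le> gromov_product z x y + \<delta>"
    | "gromov_product z w y \<le> gromov_product z x y + \<delta>"
    by (rule gromov_ineq_cases)
  then show ?thesis
  proof cases
    case 1
    then show ?thesis
      using gromov_product_double[of z x w] gromov_product_double[of z x y]
        max.cobounded2[of "dist x w + dist y z" "dist x z + dist y w"]
      by (simp add: dist_commute)
  next
    case 2
    then show ?thesis
      using gromov_product_double[of z w y] gromov_product_double[of z x y]
        max.cobounded1[of "dist x z + dist y w" "dist x w + dist y z"]
      by (simp add: dist_commute)
  qed
qed

text \<open>In \<open>four_point\<close> for \<open>x 0\<close>, \<open>x n\<close>,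
  \<open>x (n + 1)\<close>, \<open>x (n + 2)\<close> one alternative is the claim. The other says
  that the distance from \<open>x 0\<close> dropped by \<open>a\<close> in the previous step,
  against the induction hypothesis.\<close>

lemma local_to_global:
  fixes x :: "nat \<Rightarrow> 's"
  assumes "0 < a"
    and loc: "\<And>i. max (dist (x i) (x (Suc i))) (dist (x (Suc i)) (x (Suc (Suc i)))) + 2 * \<delta> + a
                \<le> dist (x i) (x (Suc (Suc i)))"
  shows "dist (x 0) (x n) + a \<le> dist (x 0) (x (Suc n))"
proof (induction n)
  case 0
  then show ?case
    using loc[of 0] dist_triangle[of "x 0" "x (Suc (Suc 0))" "x (Suc 0)"] delta_nonneg by auto
next
  case (Suc n)
  then show ?case
    using four_point[of "x 0" "x (Suc n)" "x n" "x (Suc (Suc n))"] loc[of n] assms(1)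
    by (auto simp: dist_commute max_def split: if_splits)
qed

lemma local_to_global_linear:
  fixes x :: "nat \<Rightarrow> 's"
  assumes "0 < a"
    and "\<And>i. max (dist (x i) (x (Suc i))) (dist (x (Suc i)) (x (Suc (Suc i)))) + 2 * \<delta> + a
                \<le> dist (x i) (x (Suc (Suc i)))"
  shows "real n * a \<le> dist (x 0) (x n)"
proof (induction n)
  case (Suc n)
  then show ?case using local_to_global[of a x n] assms by (simp add: algebra_simps)
qed simp

end

text \<open>Abstracts the orbit map \<open>P n = g\<^sup>n x\<close> of a loxodromic isometry \<open>g\<close>.\<close>

locale quasi_axis = gromov_hyperbolic X \<delta> for X :: "'s::metric_space itself" and \<delta> +
  fixes P :: "int \<Rightarrow> 's" and c C :: real
  assumes homogeneous: "dist (P m) (P n) = dist (P 0) (P (n - m))"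
    and c_pos: "0 < c" and growth: "c * \<bar>real_of_int n\<bar> - C \<le> dist (P 0) (P n)"
begin

definition len :: "int \<Rightarrow> real" where "len n = dist (P 0) (P n)"

lemma dist_P: "dist (P m) (P n) = len (n - m)"
  unfolding len_def by (rule homogeneous)

lemma len_minus: "len (- n) = len n"
  using dist_P[of 0 n] dist_P[of n 0] by (simp add: dist_commute)

lemma len_0 [simp]: "len 0 = 0" by (simp add: len_def)

lemma len_nonneg: "0 \<le> len n" by (simp add: len_def)

lemma len_add_le: "len (m + n) \<le> len m + len n"
  using dist_triangle[of "P 0" "P (m + n)" "P m"] by (simp add: dist_P)

lemma len_mult_le: "len (int n * m) \<le> real n * len m"
proof (induction n)
  case (Suc n)
  then show ?case using len_add_le[of m "int n * m"] by (simp add: algebra_simps)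
qed simp

text \<open>Otherwise each doubling adds less than \<open>B\<close>, so \<open>len (2 ^ k)\<close>
  grows at most linearly in \<open>k\<close>, while \<open>growth\<close> makes it
  exponential.\<close>

lemma ex_len_double: "\<exists>m>0. len m + B \<le> len (2 * m)"
proof (rule ccontr)
  assume "\<not> ?thesis"
  then have *: "len (2 * m) < len m + B" if "m > 0" for m using that by (auto simp: not_le)
  have upper: "len (2 ^ k) \<le> len 1 + real k * B" for k
  proof (induction k)
    case (Suc k)
    then show ?case using *[of "2 ^ k"] by (simp add: algebra_simps)
  qed simp
  have "c * 2 ^ k - C \<le> len 1 + real k * B" for k :: nat
    using growth[of "2 ^ k"] upper[of k] by (simp add: len_def)
  then have "\<forall>k::nat. c * 2 ^ k - real k * B \<le> len 1 + C" by (simp add: algebra_simps)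
  moreover have "filterlim (\<lambda>k::nat. c * 2 ^ k - real k * B) at_top at_top"
    using c_pos by real_asymp
  then have "eventually (\<lambda>k::nat. c * 2 ^ k - real k * B > len 1 + C) at_top"
    by (simp add: filterlim_at_top_dense)
  ultimately show False by (auto simp: eventually_at_top_linorder not_le[symmetric])
qed

text \<open>Some step size \<open>m\<close> satisfies the hypothesis of \<open>local_to_global\<close>; along the
  multiples of \<open>m\<close> the Gromov inequality at \<open>P (m * j)\<close> between \<open>P (m * i)\<close>, \<open>P (m * k)\<close> and the
  neighbour \<open>P (m * (j + 1))\<close> leaves only one alternative.\<close>

lemma ex_gromov_product_bound:
  "\<exists>K\<ge>0. \<forall>i j k. i \<le> j \<longrightarrow> j \<le> k \<longrightarrow> gromov_product (P j) (P i) (P k) \<le> K"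
proof -
  \<comment> \<open>Any \<open>a > \<delta>\<close> serves. At \<open>P (m * j)\<close> the product
    with the neighbour is at most \<open>(len m - a) / 2\<close> for \<open>P (m * i)\<close> and at
    least \<open>(len m + a) / 2\<close> for \<open>P (m * k)\<close>, and this gap must exceed
    \<open>\<delta>\<close>.\<close>
  define a where "a = \<delta> + 1"
  have a: "0 < a" using delta_nonneg by (simp add: a_def)
  obtain m where m: "m > 0" "len m + (2 * \<delta> + a) \<le> len (2 * m)"
    using ex_len_double by blast
  have mono: "len (m * int n) + a \<le> len (m * int (Suc n))" for n
  proof -
    have "dist (P (m * int 0)) (P (m * int n)) + a \<le> dist (P (m * int 0)) (P (m * int (Suc n)))"
      by (rule local_to_global[of a "\<lambda>n. P (m * int n)"]) (use a m in \<open>auto simp: dist_P algebra_simps\<close>)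
    then show ?thesis by (simp add: dist_P)
  qed
  have mono': "len (m * n) + a \<le> len (m * (n + 1))" if "n \<ge> 0" for n
    using mono[of "nat n"] that by (simp add: add.commute)
  have coarse: "gromov_product (P (m * j)) (P (m * i)) (P (m * k)) \<le> len m + \<delta>"
    if "i \<le> j" "j \<le> k" for i j k
  proof (cases "j = k")
    case True
    then show ?thesis using len_nonneg[of m] delta_nonneg by (simp add: gromov_product_def)
  next
    case False
    define p where "p = P (m * j)"
    have "len (m * (k - j - 1)) + a \<le> len (m * (k - j))" "len (m * (j - i)) + a \<le> len (m * (j + 1 - i))"
      using mono'[of "k - j - 1"] mono'[of "j - i"] that False by (simp_all add: algebra_simps)
    moreover have "dist p (P (m * i)) = len (m * (j - i))" "dist p (P (m * k)) = len (m * (k - j))"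
      "dist p (P (m * (j + 1))) = len m" "dist (P (m * i)) (P (m * (j + 1))) = len (m * (j + 1 - i))"
      "dist (P (m * k)) (P (m * (j + 1))) = len (m * (k - j - 1))"
      unfolding p_def using len_minus[of "m * (j - i)"] len_minus[of "m * (k - j - 1)"]
      by (simp_all add: dist_P algebra_simps)
    ultimately have "2 * gromov_product p (P (m * i)) (P (m * (j + 1))) \<le> len m - a"
      "len m + a \<le> 2 * gromov_product p (P (m * k)) (P (m * (j + 1)))"
      by (simp_all add: gromov_product_def dist_commute[of _ p])
    then have "gromov_product p (P (m * i)) (P (m * k)) \<le> len m + \<delta>"
      using gromov_ineq[of p "P (m * i)" "P (m * k)" "P (m * (j + 1))"] delta_nonneg len_nonneg[of m]
      unfolding a_def by linarith
    then show ?thesis by (simp add: p_def)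
  qed
  \<comment> \<open>Rounding an index down to a multiple of \<open>m\<close> moves its point by at
    most \<open>E\<close>, and a Gromov product has three points to round.\<close>
  define E where "E = real (nat m) * len 1"
  have E: "dist (P i) (P (m * (i div m))) \<le> E" for i
  proof -
    have "dist (P i) (P (m * (i div m))) = len (i mod m)"
      using dist_P[of "m * (i div m)" i] by (simp add: dist_commute minus_mult_div_eq_mod)
    also have "\<dots> \<le> real (nat (i mod m)) * len 1"
      using len_mult_le[of "nat (i mod m)" 1] m by simp
    also have "\<dots> \<le> E" unfolding E_def
      using m by (intro mult_right_mono) (auto simp: len_nonneg intro: less_imp_le)
    finally show ?thesis .
  qed
  have "gromov_product (P j) (P i) (P k) \<le> len m + \<delta> + 3 * E" if "i \<le> j" "j \<le> k" for i j k
    using gromov_product_perturb[of "P j" "P i" "P k" "P (m * (j div m))" "P (m * (i div m))" "P (m * (k div m))"]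
      coarse[of "i div m" "j div m" "k div m"] E[of i] E[of j] E[of k] that m
    by (simp add: zdiv_mono1)
  moreover have "0 \<le> len m + \<delta> + 3 * E"
    using len_nonneg[of m] delta_nonneg by (simp add: E_def len_nonneg)
  ultimately show ?thesis by blast
qed

text \<open>Measures how far the axis is from a geodesic: for \<open>m, n \<ge> 0\<close> the length
  of \<open>m + n\<close> falls short of \<open>len m + len n\<close> by at most
  \<open>2 * K\<close>.\<close>

definition K :: real where
  "K = (SOME K. K \<ge> 0 \<and> (\<forall>i j k. i \<le> j \<longrightarrow> j \<le> k \<longrightarrow> gromov_product (P j) (P i) (P k) \<le> K))"

lemma K: "0 \<le> K" "i \<le> j \<Longrightarrow> j \<le> k \<Longrightarrow> gromov_product (P j) (P i) (P k) \<le> K"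
proof -
  have "K \<ge> 0 \<and> (\<forall>i j k. i \<le> j \<longrightarrow> j \<le> k \<longrightarrow> gromov_product (P j) (P i) (P k) \<le> K)"
    unfolding K_def by (rule someI_ex) (rule ex_gromov_product_bound)
  then show "0 \<le> K" "i \<le> j \<Longrightarrow> j \<le> k \<Longrightarrow> gromov_product (P j) (P i) (P k) \<le> K" by blast+
qed

lemma len_add_ge:
  assumes "0 \<le> m" "0 \<le> n"
  shows "len m + len n - 2 * K \<le> len (m + n)"
  using K(2)[of 0 m "m + n"] assms by (simp add: gromov_product_def dist_commute[of "P m"] dist_commute[of "P (m + n)"] dist_P len_minus)

lemma dist_P_le:
  assumes "0 \<le> m" "0 \<le> n"
  shows "dist (P m) (P n) \<le> \<bar>len m - len n\<bar> + 2 * K"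
  using assms
proof (induction m n rule: linorder_wlog)
  case (le m n)
  then show ?case using len_add_ge[of m "n - m"] by (simp add: dist_P)
next
  case (sym m n)
  then show ?case by (simp add: dist_commute)
qed

text \<open>Choose \<open>j\<close> so that \<open>P j\<close> divides the way from
  \<open>P i\<close> to \<open>P k\<close> in nearly the same proportion as \<open>w\<close>. Both
  points almost realize the distance of the ends, so \<open>four_point\<close> makes them
  close.\<close>

lemma near_point:
  assumes "i \<le> k" and L: "gromov_product w (P i) (P k) \<le> L"
  obtains j where "i \<le> j" "j \<le> k" "dist w (P j) \<le> K + L + len 1 + 2 * \<delta>"
proof -
  \<comment> \<open>The difference of the distances to the two ends serves as a coordinate along the
    axis; \<open>T\<close> is the coordinate of \<open>w\<close>.\<close>
  define f where "f n = dist (P (i + int n)) (P i) - dist (P (i + int n)) (P k)" for n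
  define T where "T = dist w (P i) - dist w (P k)"
  have step: "\<bar>f (Suc n) - f n\<bar> \<le> 2 * len 1" for n
  proof -
    have "dist (P (i + int n)) (P (i + int (Suc n))) = len 1" by (simp add: dist_P)
    then show ?thesis unfolding f_def
      using dist_triangle[of "P (i + int n)" "P i" "P (i + int (Suc n))"]
        dist_triangle[of "P (i + int n)" "P k" "P (i + int (Suc n))"]
        dist_triangle[of "P (i + int (Suc n))" "P i" "P (i + int n)"]
        dist_triangle[of "P (i + int (Suc n))" "P k" "P (i + int n)"]
      by (auto simp: dist_commute abs_le_iff)
  qed
  have "f 0 \<le> T" "T \<le> f (nat (k - i))"
    using assms(1) dist_triangle[of "P i" "P k" w] dist_triangle[of w "P k" "P i"] dist_triangle[of w "P i" "P k"]
    unfolding f_def T_def by (simp_all add: dist_commute)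
  then obtain n where n: "n \<le> nat (k - i)" "\<bar>f n - T\<bar> \<le> 2 * len 1"
    using discrete_intermediate_value[of f T "nat (k - i)" "2 * len 1"] step by blast
  define j where "j = i + int n"
  have j: "i \<le> j" "j \<le> k" using n assms by (auto simp: j_def)
  have "gromov_product (P j) (P i) (P k) \<le> K" using K j by blast
  then have "dist (P j) (P i) + dist (P j) (P k) \<le> dist (P i) (P k) + 2 * K"
    "dist w (P i) + dist w (P k) \<le> dist (P i) (P k) + 2 * L"
    using L by (simp_all add: gromov_product_def dist_commute)
  moreover have "\<bar>(dist (P j) (P i) - dist (P j) (P k)) - (dist w (P i) - dist w (P k))\<bar> \<le> 2 * len 1"
    using n(2) unfolding f_def T_def j_def by simp
  ultimately have "max (dist w (P i) + dist (P j) (P k)) (dist w (P k) + dist (P j) (P i))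
      \<le> dist (P i) (P k) + K + L + len 1"
    by (simp add: abs_le_iff)
  then have "dist w (P j) \<le> K + L + len 1 + 2 * \<delta>"
    using four_point[of w "P j" "P i" "P k"] by linarith
  then show ?thesis using j that by blast
qed

lemma gromov_product_opposite: "gromov_product (P 0) (P m) (P (- m)) \<le> K"
  using K(2)[of "- m" 0 m] K(2)[of m 0 "- m"] by (cases "0 \<le> m") (simp_all add: gromov_product_commute)

lemma near_point_opposite:
  assumes "gromov_product w (P m) (P (- m)) \<le> L"
  obtains j where "dist w (P j) \<le> K + L + len 1 + 2 * \<delta>"
proof (cases "0 \<le> m")
  case True
  then show ?thesis
    using near_point[of "- m" m w L] assms that by (auto simp: gromov_product_commute)
next
  case False
  then show ?thesis using near_point[of m "- m" w L] assms that by auto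
qed

lemma len_at_top: "\<exists>n0. \<forall>n\<ge>n0. B \<le> len n"
proof -
  have "B \<le> len n" if "n \<ge> \<lceil>(B + C) / c\<rceil>" for n
  proof -
    have "(B + C) / c \<le> real_of_int n" using that by linarith
    then have "B + C \<le> c * real_of_int n" using c_pos by (simp add: field_simps)
    also have "\<dots> \<le> c * \<bar>real_of_int n\<bar>" using c_pos by simp
    finally show ?thesis using growth[of n] by (simp add: len_def)
  qed
  then show ?thesis by blast
qed

end

section \<open>Orbits of loxodromic elements\<close>

context group
begin

lemma int_pow_intertwine:
  assumes "f \<in> carrier G" "u \<in> carrier G" "v \<in> carrier G" "f \<otimes> u = v \<otimes> f"
  shows "f \<otimes> u [^] (n::int) = v [^] n \<otimes> f"
proof -
  have nat: "f \<otimes> u [^] k = v [^] k \<otimes> f" for k :: nat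
  proof (induction k)
    case (Suc k)
    have "f \<otimes> u [^] Suc k = v [^] k \<otimes> f \<otimes> u" using assms Suc by (simp add: m_assoc[symmetric])
    also have "\<dots> = v [^] Suc k \<otimes> f" using assms by (simp add: m_assoc)
    finally show ?case .
  qed (use assms in simp)
  show ?thesis
  proof (cases n)
    case (nonneg k)
    then show ?thesis using nat by (simp add: int_pow_int)
  next
    case (neg k)
    define a b where "a = u [^] Suc k" and "b = v [^] Suc k"
    have ab: "a \<in> carrier G" "b \<in> carrier G" "f \<otimes> a = b \<otimes> f"
      using assms nat[of "Suc k"] by (simp_all add: a_def b_def del: nat_pow_Suc)
    have "f \<otimes> inv a = inv b \<otimes> (b \<otimes> f) \<otimes> inv a"
      using ab assms by (simp add: m_assoc[symmetric])
    also have "\<dots> = inv b \<otimes> f" using ab assms by (simp add: ab(3)[symmetric] m_assoc)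
    finally show ?thesis
      using assms by (simp add: neg int_pow_neg_int a_def b_def del: nat_pow_Suc of_nat_Suc)
  qed
qed

lemma int_pow_conj:
  assumes "f \<in> carrier G" "g \<in> carrier G"
  shows "(f \<otimes> g \<otimes> inv f) [^] (n::int) = f \<otimes> g [^] n \<otimes> inv f"
proof -
  have "f \<otimes> g [^] n = (f \<otimes> g \<otimes> inv f) [^] n \<otimes> f"
    by (rule int_pow_intertwine) (use assms in \<open>simp_all add: m_assoc\<close>)
  then show ?thesis using assms by (simp add: inv_solve_right)
qed

text \<open>Turns a coincidence found by the pigeonhole principle into a common power.\<close>

lemma int_pow_quotient_eq:
  assumes "g \<in> carrier G" "h \<in> carrier G"
    and eq: "h [^] (a::int) \<otimes> g [^] (b::int) = h [^] (a'::int) \<otimes> g [^] (b'::int)"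
  shows "g [^] (b - b') = h [^] (a' - a)"
proof -
  have "g [^] b = h [^] (- a) \<otimes> (h [^] a \<otimes> g [^] b)"
    using assms(1,2) by (simp add: m_assoc[symmetric] int_pow_mult[symmetric])
  also have "\<dots> = h [^] (a' - a) \<otimes> g [^] b'"
    using assms(1,2) unfolding eq by (simp add: m_assoc[symmetric] int_pow_mult[symmetric])
  finally have "g [^] b \<otimes> g [^] (- b') = h [^] (a' - a) \<otimes> g [^] b' \<otimes> g [^] (- b')" by simp
  then show ?thesis using assms(1,2) by (simp add: m_assoc int_pow_mult[symmetric])
qed

end

section \<open>Isometric actions and criteria for loxodromic elements\<close>

locale hyperbolic_action = gromov_hyperbolic X \<delta> + group G
  for X :: "'s::metric_space itself" and \<delta> :: real
    and G :: "('g, 'm) monoid_scheme" (structure) and \<phi> :: "'g \<Rightarrow> 's \<Rightarrow> 's" +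
  assumes isometric: "isometric_action G \<phi>"
begin

lemma act_mult: "g \<in> carrier G \<Longrightarrow> h \<in> carrier G \<Longrightarrow> \<phi> (g \<otimes> h) x = \<phi> g (\<phi> h x)"
  using isometric group_action.composition_rule[of G UNIV \<phi> x g h] by (simp add: isometric_action_def)

lemma act_one [simp]: "\<phi> \<one> x = x"
  using isometric group_action.id_eq_one[of G UNIV \<phi>] by (metis isometric_action_def restrict_UNIV)

lemma act_dist [simp]: "g \<in> carrier G \<Longrightarrow> dist (\<phi> g x) (\<phi> g y) = dist x y"
  using isometric by (simp add: isometric_action_def)

lemma dist_inv_mult:
  assumes "g \<in> carrier G" "h \<in> carrier G"
  shows "dist x (\<phi> (inv g \<otimes> h) y) = dist (\<phi> g x) (\<phi> h y)"
proof -
  have "dist (\<phi> g x) (\<phi> g (\<phi> (inv g \<otimes> h) y)) = dist x (\<phi> (inv g \<otimes> h) y)"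
    using assms by simp
  moreover have "\<phi> g (\<phi> (inv g \<otimes> h) y) = \<phi> h y"
    using assms by (simp add: act_mult[symmetric] m_assoc[symmetric])
  ultimately show ?thesis by simp
qed

lemma dist_inv: "g \<in> carrier G \<Longrightarrow> dist x (\<phi> (inv g) y) = dist (\<phi> g x) y"
  using dist_inv_mult[of g \<one> x y] by simp

lemma gromov_product_act:
  "g \<in> carrier G \<Longrightarrow> gromov_product (\<phi> g s) (\<phi> g x) (\<phi> g y) = gromov_product s x y"
  by (simp add: gromov_product_def)

lemma act_pow_add:
  "g \<in> carrier G \<Longrightarrow> \<phi> (g [^] (m::int)) (\<phi> (g [^] (n::int)) x) = \<phi> (g [^] (m + n)) x"
  by (simp add: act_mult[symmetric] int_pow_mult)

lemma dist_act_pow: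
  assumes "g \<in> carrier G"
  shows "dist (\<phi> (g [^] (m::int)) x) (\<phi> (g [^] (n::int)) x) = dist x (\<phi> (g [^] (n - m)) x)"
  using act_dist[of "g [^] m" x "\<phi> (g [^] (n - m)) x"] assms by (simp add: act_pow_add)

lemma dist_act_pow_le:
  assumes "g \<in> carrier G"
  shows "dist x (\<phi> (g [^] (n::int)) x) \<le> \<bar>real_of_int n\<bar> * dist x (\<phi> g x)"
proof -
  have nat: "dist x (\<phi> (g [^] int k) x) \<le> real k * dist x (\<phi> g x)" for k
  proof (induction k)
    case (Suc k)
    have "dist (\<phi> (g [^] int k) x) (\<phi> (g [^] int (Suc k)) x) = dist x (\<phi> g x)"
      using assms by (subst dist_act_pow) simp_all
    then show ?case
      using Suc dist_triangle[of x "\<phi> (g [^] int (Suc k)) x" "\<phi> (g [^] int k) x"]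
      by (simp add: algebra_simps del: of_nat_Suc) (simp add: algebra_simps)
  qed simp
  have "dist x (\<phi> (g [^] n) x) = dist x (\<phi> (g [^] \<bar>n\<bar>) x)"
    using dist_act_pow[OF assms, of n x 0] by (cases "0 \<le> n") (simp_all add: dist_commute)
  then show ?thesis using nat[of "nat \<bar>n\<bar>"] by simp
qed

text \<open>The upper bound is automatic from \<open>dist_act_pow_le\<close>, and by invariance only
  the absolute value of the difference of two exponents matters.\<close>

lemma loxodromicI:
  assumes "g \<in> carrier G" "0 < c" and lower: "\<And>n. c * real n - C \<le> dist x (\<phi> (g [^] int n) x)"
  shows "loxodromic G \<phi> g"
proof -
  \<comment> \<open>The three entries give \<open>A \<ge> 1\<close>, the lower bound through
    \<open>1 / A \<le> c\<close>, and the upper bound.\<close>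
  define A where "A = Max {1, 1 / c, dist x (\<phi> g x)}"
  have A: "1 \<le> A" "1 / c \<le> A" "dist x (\<phi> g x) \<le> A" by (simp_all add: A_def)
  have "real_of_int \<bar>m - n\<bar> / A - \<bar>C\<bar> \<le> dist (\<phi> (g [^] m) x) (\<phi> (g [^] n) x) \<and>
      dist (\<phi> (g [^] m) x) (\<phi> (g [^] n) x) \<le> A * real_of_int \<bar>m - n\<bar> + \<bar>C\<bar>" for m n
  proof -
    define k where "k = nat \<bar>m - n\<bar>"
    have k: "real_of_int \<bar>m - n\<bar> = real k" by (simp add: k_def)
    have eq: "dist (\<phi> (g [^] m) x) (\<phi> (g [^] n) x) = dist x (\<phi> (g [^] int k) x)"
      using dist_act_pow[OF assms(1), of m x n] dist_act_pow[OF assms(1), of n x m]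
      by (cases "m \<le> n") (simp_all add: k_def dist_commute)
    have "real k / A \<le> c * real k"
    proof -
      have "1 / A \<le> c" using A assms(2) by (simp add: field_simps)
      then show ?thesis using mult_right_mono[of "1 / A" c "real k"] by simp
    qed
    moreover have "dist x (\<phi> (g [^] int k) x) \<le> A * real k"
      using dist_act_pow_le[OF assms(1), of x "int k"] mult_right_mono[OF A(3), of "real k"]
      by (simp add: mult.commute)
    ultimately show ?thesis unfolding k eq using lower[of k] by (simp add: abs_if)
  qed
  then show ?thesis
    unfolding loxodromic_def quasi_isometric_embedding_def
    using assms(1) A(1) by (intro conjI exI[of _ x] exI[of _ A] exI[of _ "\<bar>C\<bar>"]) auto
qed

lemma loxodromic_carrier: "loxodromic G \<phi> g \<Longrightarrow> g \<in> carrier G"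
  by (simp add: loxodromic_def)

text \<open>The definition of loxodromic provides some base point \<open>s\<close>; passing to an
  arbitrary \<open>x\<close> only enlarges the additive constant by
  \<open>2 * dist x s\<close>.\<close>

lemma loxodromic_quasi_axis:
  assumes "loxodromic G \<phi> g"
  shows "\<exists>c C. quasi_axis \<delta> (\<lambda>n. \<phi> (g [^] (n::int)) x) c C"
proof -
  have g: "g \<in> carrier G" using assms by (rule loxodromic_carrier)
  obtain s A C where A: "A \<ge> 1" "C \<ge> 0" and
    low: "\<And>m n. real_of_int \<bar>m - n\<bar> / A - C \<le> dist (\<phi> (g [^] m) s) (\<phi> (g [^] (n::int)) s)"
    using assms unfolding loxodromic_def quasi_isometric_embedding_def by blast
  have "1 / A * \<bar>real_of_int n\<bar> - (C + 2 * dist x s) \<le> dist x (\<phi> (g [^] n) x)" for n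
  proof -
    have "dist s (\<phi> (g [^] n) s) \<le> dist x s + dist x (\<phi> (g [^] n) x) + dist (\<phi> (g [^] n) x) (\<phi> (g [^] n) s)"
      by metric
    then show ?thesis using low[of 0 n] g by simp
  qed
  then have "quasi_axis \<delta> (\<lambda>n. \<phi> (g [^] (n::int)) x) (1 / A) (C + 2 * dist x s)"
    using A by unfold_locales (simp_all add: dist_act_pow g)
  then show ?thesis by blast
qed

lemma loxodromic_pow_neq_one:
  assumes "loxodromic G \<phi> g" "n \<noteq> 0"
  shows "g [^] (n::int) \<noteq> \<one>"
proof
  assume eq: "g [^] n = \<one>"
  have g: "g \<in> carrier G" using assms(1) by (rule loxodromic_carrier)
  \<comment> \<open>Here \<open>undefined\<close> is just some point of the space.\<close>
  obtain c C where "quasi_axis \<delta> (\<lambda>k. \<phi> (g [^] (k::int)) undefined) c C"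
    using loxodromic_quasi_axis[OF assms(1)] by blast
  then interpret quasi_axis X \<delta> "\<lambda>k. \<phi> (g [^] (k::int)) undefined" c C .
  obtain n0 where n0: "\<And>k. k \<ge> n0 \<Longrightarrow> 1 \<le> len k" using len_at_top[of 1] by blast
  have "n0 \<le> \<bar>n\<bar> * \<bar>n0\<bar>" using assms(2) by (smt (verit) mult_le_cancel_right1)
  then have "1 \<le> len (\<bar>n\<bar> * \<bar>n0\<bar>)" by (rule n0)
  moreover have "g [^] (\<bar>n\<bar> * \<bar>n0\<bar>) = \<one>"
    using g eq by (cases "0 \<le> n") (simp_all add: int_pow_pow[symmetric] int_pow_neg)
  ultimately show False by (simp add: len_def)
qed

text \<open>The isometry \<open>f\<close> carries the orbit under powers of \<open>g\<close> to the
  orbit of the translated base point under powers of the conjugate.\<close>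

lemma loxodromic_conj:
  assumes "loxodromic G \<phi> g" "f \<in> carrier G"
  shows "loxodromic G \<phi> (f \<otimes> g \<otimes> inv f)"
proof -
  have g: "g \<in> carrier G" using assms(1) by (rule loxodromic_carrier)
  obtain c C where "quasi_axis \<delta> (\<lambda>k. \<phi> (g [^] (k::int)) undefined) c C"
    using loxodromic_quasi_axis[OF assms(1)] by blast
  then interpret quasi_axis X \<delta> "\<lambda>k. \<phi> (g [^] (k::int)) undefined" c C .
  have "c * real n - C \<le> dist (\<phi> f undefined) (\<phi> ((f \<otimes> g \<otimes> inv f) [^] int n) (\<phi> f undefined))" for n
  proof -
    have "f \<otimes> g [^] int n \<otimes> inv f \<otimes> f = f \<otimes> g [^] int n"
      using g assms(2) by (simp add: m_assoc)
    then have "\<phi> ((f \<otimes> g \<otimes> inv f) [^] int n) (\<phi> f undefined) = \<phi> f (\<phi> (g [^] int n) undefined)"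
      using g assms(2) act_mult[of "f \<otimes> g [^] int n \<otimes> inv f" f undefined]
        act_mult[of f "g [^] int n" undefined]
      by (simp add: int_pow_conj)
    then show ?thesis using growth[of "int n"] assms(2) by simp
  qed
  then show ?thesis using loxodromicI[of _ c C] c_pos g assms(2) by blast
qed

lemma loxodromic_pow:
  assumes "loxodromic G \<phi> g" "m \<noteq> 0"
  shows "loxodromic G \<phi> (g [^] (m::int))"
proof -
  have g: "g \<in> carrier G" using assms(1) by (rule loxodromic_carrier)
  obtain c C where "quasi_axis \<delta> (\<lambda>k. \<phi> (g [^] (k::int)) undefined) c C"
    using loxodromic_quasi_axis[OF assms(1)] by blast
  then interpret quasi_axis X \<delta> "\<lambda>k. \<phi> (g [^] (k::int)) undefined" c C .
  have "c * real n - C \<le> dist undefined (\<phi> ((g [^] m) [^] int n) undefined)" for n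
  proof -
    have "c * real n \<le> c * \<bar>real_of_int (m * int n)\<bar>"
      using c_pos assms(2) by (simp add: abs_mult mult_le_cancel_right1) linarith
    then show ?thesis using growth[of "m * int n"] g by (simp add: int_pow_pow)
  qed
  then show ?thesis using loxodromicI[of _ c C] c_pos g by blast
qed

text \<open>Consecutive points of the orbit of the cyclic group generated by \<open>g \<otimes> h\<close>, together with
  the intermediate points \<open>(g \<otimes> h)\<^sup>i g x\<close>, form a local quasi-geodesic.\<close>

lemma loxodromic_mult:
  assumes g: "g \<in> carrier G" and h: "h \<in> carrier G"
    and gh: "max (dist x (\<phi> g x)) (dist x (\<phi> h x)) + 2 * \<delta> + 1 \<le> dist x (\<phi> (g \<otimes> h) x)"
    and hg: "max (dist x (\<phi> g x)) (dist x (\<phi> h x)) + 2 * \<delta> + 1 \<le> dist x (\<phi> (h \<otimes> g) x)"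
  shows "loxodromic G \<phi> (g \<otimes> h)"
proof -
  let ?k = "g \<otimes> h"
  define y where "y n = (if even n then \<phi> (?k [^] (n div 2)) x else \<phi> (?k [^] (n div 2)) (\<phi> g x))" for n :: nat
  have "\<phi> (?k [^] Suc n) z = \<phi> ?k (\<phi> (?k [^] n) z)" for n :: nat and z
    using g h act_mult[of ?k "?k [^] n" z] nat_pow_Suc2[of ?k n] by simp
  then have yS: "y (Suc (Suc n)) = \<phi> ?k (y n)" for n
    by (simp add: y_def del: nat_pow_Suc)
  have y012: "y 0 = x" "y (Suc 0) = \<phi> g x" by (simp_all add: y_def)
  \<comment> \<open>Since \<open>g \<otimes> h\<close> shifts the path by two, all these distances
    are determined by its first points. The distance starting at odd indices involves
    \<open>h \<otimes> g\<close>, which is where \<open>hg\<close> enters.\<close>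
  have d01: "dist (y (2 * i)) (y (Suc (2 * i))) = dist x (\<phi> g x)"
    "dist (y (Suc (2 * i))) (y (Suc (Suc (2 * i)))) = dist x (\<phi> h x)" for i
  proof (induction i)
    case 0
    { case 1 then show ?case by (simp add: y012) }
    { case 2 then show ?case using g h by (simp add: yS y012 act_mult) }
  next
    case (Suc i)
    { case 1 then show ?case using Suc g h by (simp add: yS) }
    { case 2 then show ?case using Suc g h by (simp add: yS) }
  qed
  have d2: "dist (y (2 * i)) (y (Suc (Suc (2 * i)))) = dist x (\<phi> (g \<otimes> h) x)"
    "dist (y (Suc (2 * i))) (y (Suc (Suc (Suc (2 * i))))) = dist x (\<phi> (h \<otimes> g) x)" for i
  proof (induction i)
    case 0
    { case 1 then show ?case by (simp add: yS y012) }
    { case 2 then show ?case using g h act_dist[of g x "\<phi> (h \<otimes> g) x"] by (simp add: yS y012 act_mult) }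
  next
    case (Suc i)
    { case 1 then show ?case using Suc g h by (simp add: yS) }
    { case 2 then show ?case using Suc g h by (simp add: yS) }
  qed
  have "max (dist (y i) (y (Suc i))) (dist (y (Suc i)) (y (Suc (Suc i)))) + 2 * \<delta> + 1
      \<le> dist (y i) (y (Suc (Suc i)))" for i
  proof (cases "even i")
    case True
    then obtain j where "i = 2 * j" by blast
    then show ?thesis using d01[of j] d2[of j] gh by simp
  next
    case False
    then obtain j where "i = Suc (2 * j)" using oddE by fastforce
    then show ?thesis using d01(2)[of j] d01(1)[of "Suc j"] d2(2)[of j] hg
      by (simp add: max.commute)
  qed
  then have "real n * 1 \<le> dist (y 0) (y n)" for n
    by (intro local_to_global_linear) auto
  from this[of "2 * _"] have "2 * real n \<le> dist x (\<phi> (?k [^] int n) x)" for n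
    by (simp add: y_def int_pow_int)
  then show ?thesis using loxodromicI[of ?k 2 0 x] g h by simp
qed

end

section \<open>Commensurability of loxodromic elements\<close>

locale acylindrical_hyperbolic_action = hyperbolic_action X \<delta> G \<phi>
  for X :: "'s::metric_space itself" and \<delta> :: real
    and G :: "('g, 'm) monoid_scheme" (structure) and \<phi> :: "'g \<Rightarrow> 's \<Rightarrow> 's" +
  assumes acylindrical: "acylindrical_action G \<phi>"
begin

text \<open>A form of acylindricity ready for chosen sets \<open>T\<close> and for \<open>e\<close>
  of any sign; \<open>max e 1\<close> reduces it to a positive bound.\<close>

lemma acylindrical_card:
  "\<exists>R N. \<forall>x y T. R \<le> dist x y \<longrightarrow> T \<subseteq> carrier G \<longrightarrow>
     (\<forall>g\<in>T. dist x (\<phi> g x) \<le> e \<and> dist y (\<phi> g y) \<le> e) \<longrightarrow> finite T \<and> card T \<le> (N :: nat)"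
proof -
  define e' where "e' = max e 1"
  have "0 < e'" by (simp add: e'_def)
  then obtain R :: real and N :: nat where RN: "\<And>x y. R \<le> dist x y \<Longrightarrow>
      finite {g \<in> carrier G. dist x (\<phi> g x) \<le> e' \<and> dist y (\<phi> g y) \<le> e'} \<and>
      card {g \<in> carrier G. dist x (\<phi> g x) \<le> e' \<and> dist y (\<phi> g y) \<le> e'} \<le> N"
    using acylindrical unfolding acylindrical_action_def by meson
  have "finite T \<and> card T \<le> N"
    if "R \<le> dist x y" "T \<subseteq> carrier G"
      "\<forall>g\<in>T. dist x (\<phi> g x) \<le> e \<and> dist y (\<phi> g y) \<le> e" for x y T
  proof -
    have "T \<subseteq> {g \<in> carrier G. dist x (\<phi> g x) \<le> e' \<and> dist y (\<phi> g y) \<le> e'}"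
      using that(2,3) by (fastforce simp: e'_def max_def)
    then show ?thesis
      using RN[OF that(1)] by (meson card_mono finite_subset le_trans)
  qed
  then show ?thesis by blast
qed

text \<open>Divergence forces the positive half-orbit of \<open>g\<close> to follow that of
  \<open>h\<close>, with \<open>P i\<close> near \<open>Q (j i)\<close>. The map \<open>j\<close> is
  additive up to a bounded error, so \<open>h\<^sup>-\<^sup>j\<^sup>i g\<^sup>i\<close>, with
  exponent \<open>j i\<close> on \<open>h\<close>, moves every \<open>P m\<close> with
  \<open>m \<ge> 0\<close> boundedly. Acylindricity makes two of these elements coincide.\<close>

lemma common_power_of_divergence:
  assumes lox: "loxodromic G \<phi> g" "loxodromic G \<phi> h"
    and div: "\<And>M. \<exists>k\<ge>0. \<exists>l\<ge>0. M \<le> gromov_product x (\<phi> (g [^] (k::int)) x) (\<phi> (h [^] (l::int)) x)"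
  shows "\<exists>m n. m \<noteq> 0 \<and> n \<noteq> 0 \<and> g [^] (m::int) = h [^] (n::int)"
proof -
  have g: "g \<in> carrier G" and h: "h \<in> carrier G" using lox loxodromic_carrier by blast+
  define P where "P n = \<phi> (g [^] n) x" for n :: int
  define Q where "Q n = \<phi> (h [^] n) x" for n :: int
  obtain c C where "quasi_axis \<delta> P c C" using loxodromic_quasi_axis[OF lox(1)] unfolding P_def by blast
  then interpret a: quasi_axis X \<delta> P c C .
  obtain c' C' where "quasi_axis \<delta> Q c' C'" using loxodromic_quasi_axis[OF lox(2)] unfolding Q_def by blast
  then interpret b: quasi_axis X \<delta> Q c' C' .
  have PQ0: "P 0 = x" "Q 0 = x" by (simp_all add: P_def Q_def)
  define D where "D = b.K + (a.K + \<delta>) + b.len 1 + 2 * \<delta>"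
  have len_le: "a.len k \<le> real_of_int i * a.len 1" if "0 \<le> k" "k \<le> i" for k i
  proof -
    have "a.len k \<le> real_of_int k * a.len 1" using a.len_mult_le[of "nat k" 1] that by simp
    also have "\<dots> \<le> real_of_int i * a.len 1" using that a.len_nonneg by (intro mult_right_mono) auto
    finally show ?thesis .
  qed
  have near: "\<exists>j\<ge>0. dist (P i) (Q j) \<le> D" if i: "0 \<le> i" for i
  proof -
    \<comment> \<open>A product of at least \<open>M\<close> forces \<open>k\<close> beyond
      \<open>i\<close>, and stays above \<open>a.K + \<delta>\<close> after the base point moves to
      \<open>P i\<close>.\<close>
    define M where "M = real_of_int i * a.len 1 + a.K + \<delta> + 1"
    obtain k l where kl: "0 \<le> k" "0 \<le> l" "M \<le> gromov_product x (P k) (Q l)"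
      using div[of M] unfolding P_def Q_def by blast
    have "M \<le> a.len k" using kl(3) gromov_product_le_dist[of x "P k" "Q l"] by (simp add: a.len_def PQ0)
    then have "i < k" using len_le[of k i] kl(1) a.K(1) delta_nonneg by (force simp: M_def not_less)
    have "a.K + \<delta> + 1 \<le> gromov_product (P i) (P k) (Q l)"
      using gromov_product_base_change[of x "P k" "Q l" "P i"] kl(3) len_le[of i i] i
      by (simp add: M_def a.len_def PQ0)
    moreover have "gromov_product (P i) x (P k) \<le> a.K"
      using a.K(2)[of 0 i k] i \<open>i < k\<close> by (simp add: PQ0)
    \<comment> \<open>Seen from \<open>P i\<close>, the point \<open>P k\<close> is nearly opposite
      to \<open>x\<close> while \<open>Q l\<close> lies in the direction of \<open>P k\<close>;
      hence \<open>P i\<close> is almost between \<open>x\<close> and \<open>Q l\<close>.\<close>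
    ultimately have "gromov_product (P i) x (Q l) \<le> a.K + \<delta>"
      using gromov_ineq[of "P i" x "Q l" "P k"] by (simp add: gromov_product_commute min_def split: if_splits)
    then obtain j where "0 \<le> j" "dist (P i) (Q j) \<le> D"
      using b.near_point[of 0 l "P i" "a.K + \<delta>"] kl(2) unfolding D_def PQ0 by blast
    then show ?thesis by blast
  qed
  then obtain j where j: "\<And>i. 0 \<le> i \<Longrightarrow> 0 \<le> j i" "\<And>i. 0 \<le> i \<Longrightarrow> dist (P i) (Q (j i)) \<le> D" by metis
  have "0 \<le> D" using j(2)[of 0] zero_le_dist by (meson order.trans order_refl)
  have len_close: "\<bar>b.len (j i) - a.len i\<bar> \<le> D" if "0 \<le> i" for i
    using j(2)[OF that] dist_triangle[of x "P i" "Q (j i)"] dist_triangle[of x "Q (j i)" "P i"]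
    by (simp add: a.len_def b.len_def PQ0 dist_commute abs_le_iff)
  define f where "f i = inv (h [^] j i) \<otimes> g [^] i" for i
  define e where "e = 5 * D + 2 * a.K + 4 * b.K"
  have f_carrier: "f i \<in> carrier G" for i using g h by (simp add: f_def)
  have moves: "dist (P m) (\<phi> (f i) (P m)) \<le> e" if "0 \<le> m" "0 \<le> i" for m i
  proof -
    have "dist (P m) (\<phi> (f i) (P m)) = dist (\<phi> (h [^] j i) (P m)) (P (i + m))"
      using g h by (simp add: f_def dist_inv_mult) (simp add: P_def act_pow_add)
    also have "\<dots> \<le> dist (\<phi> (h [^] j i) (P m)) (\<phi> (h [^] j i) (Q (j m)))
        + dist (Q (j i + j m)) (Q (j (i + m))) + dist (Q (j (i + m))) (P (i + m))"
      using h dist_triangle[of "\<phi> (h [^] j i) (P m)" "P (i + m)" "Q (j i + j m)"]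
        dist_triangle[of "Q (j i + j m)" "P (i + m)" "Q (j (i + m))"]
      by (simp add: Q_def act_pow_add)
    also have "\<dots> \<le> D + (\<bar>b.len (j i + j m) - b.len (j (i + m))\<bar> + 2 * b.K) + D"
      using j[of m] j[of "i + m"] j(1)[of i] that h by (intro add_mono b.dist_P_le) (simp_all add: dist_commute)
    \<comment> \<open>Lengths on both axes are almost additive and correspond under \<open>j\<close>
      up to \<open>D\<close>, once for each of \<open>i\<close>, \<open>m\<close> and
      \<open>i + m\<close>.\<close>
    also have "\<bar>b.len (j i + j m) - b.len (j (i + m))\<bar> \<le> 3 * D + 2 * a.K + 2 * b.K"
      using len_close[of i] len_close[of m] len_close[of "i + m"] that
        b.len_add_le[of "j i" "j m"] b.len_add_ge[of "j i" "j m"] j(1)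
        a.len_add_le[of i m] a.len_add_ge[of i m] a.K(1) b.K(1)
      by (simp add: abs_le_iff)
    finally show ?thesis by (simp add: e_def)
  qed
  obtain R N where RN: "\<forall>x y T. R \<le> dist x y \<longrightarrow> T \<subseteq> carrier G \<longrightarrow>
       (\<forall>g\<in>T. dist x (\<phi> g x) \<le> e \<and> dist y (\<phi> g y) \<le> e) \<longrightarrow> finite T \<and> card T \<le> (N :: nat)"
    using acylindrical_card by blast
  obtain m0 where m0: "\<And>n. m0 \<le> n \<Longrightarrow> R \<le> a.len n" using a.len_at_top by blast
  define m where "m = max 0 m0"
  have m: "0 \<le> m" "R \<le> dist (P 0) (P m)" using m0[of m] by (simp_all add: m_def a.len_def)
  have "finite (range (\<lambda>i. f (int i))) \<and> card (range (\<lambda>i. f (int i))) \<le> N"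
  proof (rule RN[rule_format, OF m(2)])
    fix u assume "u \<in> range (\<lambda>i. f (int i))"
    then show "dist (P 0) (\<phi> u (P 0)) \<le> e \<and> dist (P m) (\<phi> u (P m)) \<le> e"
      using moves[of 0] moves[OF m(1)] by auto
  qed (use f_carrier in blast)
  then have "\<not> inj (\<lambda>i. f (int i))" using finite_imageD infinite_UNIV_nat by blast
  then obtain i i' where ii: "i \<noteq> i'" "f (int i) = f (int i')" by (auto simp: inj_def)
  then have "g [^] (int i - int i') = h [^] (- j (int i') - - j (int i))"
    using g h by (intro int_pow_quotient_eq) (simp_all add: f_def int_pow_neg)
  moreover have "int i - int i' \<noteq> 0" using ii by simp
  ultimately show ?thesis
    using loxodromic_pow_neq_one[OF lox(1), of "int i - int i'"] by (metis int_pow_0)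
qed

text \<open>For loxodromic \<open>h\<close> this is the stabilizer of the pair of limit points of \<open>h\<close>.\<close>

definition commensurator :: "'g \<Rightarrow> 'g set" where
  "commensurator h = {f \<in> carrier G. \<exists>p q. p \<noteq> 0 \<and> q \<noteq> 0 \<and> f \<otimes> h [^] (q::int) = h [^] (p::int) \<otimes> f}"

lemma intertwine_pow_mult:
  assumes "f \<in> carrier G" "h \<in> carrier G" "f \<otimes> h [^] (q::int) = h [^] (p::int) \<otimes> f"
  shows "f \<otimes> h [^] (q * n) = h [^] (p * n) \<otimes> f"
  using int_pow_intertwine[of f "h [^] q" "h [^] p" n] assms by (simp add: int_pow_pow)

text \<open>Far out on both sides \<open>f\<close> maps points of the axis to within
  \<open>dist x (\<phi> f x)\<close> of the axis. Since \<open>\<phi> f x\<close> lies almost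
  between two such images, it lies almost between two axis points, and
  \<open>near_point_opposite\<close> applies.\<close>

lemma commensurator_near_axis:
  assumes lox: "loxodromic G \<phi> h"
  shows "\<exists>D. \<forall>f\<in>commensurator h. \<exists>j. dist (\<phi> f x) (\<phi> (h [^] (j::int)) x) \<le> D"
proof -
  have h: "h \<in> carrier G" using lox loxodromic_carrier by blast
  define P where "P n = \<phi> (h [^] n) x" for n :: int
  obtain c C where "quasi_axis \<delta> P c C" using loxodromic_quasi_axis[OF lox] unfolding P_def by blast
  then interpret quasi_axis X \<delta> P c C .
  have P0: "P 0 = x" by (simp add: P_def)
  have "\<exists>j. dist (\<phi> f x) (P j) \<le> K + (K + 2 * \<delta>) + len 1 + 2 * \<delta>" if fc: "f \<in> commensurator h" for f
  proof -
    obtain p q :: int where f: "f \<in> carrier G" and pq: "p \<noteq> 0" "q \<noteq> 0" "f \<otimes> h [^] q = h [^] p \<otimes> f"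
      using fc unfolding commensurator_def by blast
    let ?w = "\<phi> f x"
    define L where "L = dist x ?w"
    \<comment> \<open>The displacement \<open>L\<close> depends on \<open>f\<close>, but it only
      decides how far out the points are taken; the final bound is independent of it.\<close>
    obtain n0 where n0: "\<And>n. n0 \<le> n \<Longrightarrow> L + K + 2 * \<delta> + 1 \<le> len n" using len_at_top by blast
    define n where "n = \<bar>n0\<bar>"
    have "n0 \<le> \<bar>q * n\<bar>" using pq(2) unfolding n_def by (simp add: abs_mult) (smt (verit) mult_le_cancel_right1)
    then have "L + K + 2 * \<delta> + 1 \<le> len \<bar>q * n\<bar>" by (rule n0)
    then have far: "L + K + 2 * \<delta> + 1 \<le> len (q * n)" "L + K + 2 * \<delta> + 1 \<le> len (- (q * n))"
      using len_minus[of "q * n"] by (auto simp: abs_if split: if_splits)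
    have close: "dist (\<phi> f (P (q * k))) (P (p * k)) = L" for k
    proof -
      have "\<phi> f (P (q * k)) = \<phi> (h [^] (p * k)) ?w"
        using f h intertwine_pow_mult[OF f h pq(3), of k] by (simp add: P_def act_mult[symmetric])
      then show ?thesis using h by (simp add: P_def L_def dist_commute)
    qed
    have fd: "dist ?w (\<phi> f (P k)) = len k" for k using f by (simp add: len_def P0)
    define a b where "a = P (p * n)" and "b = P (- (p * n))"
    define a' b' where "a' = \<phi> f (P (q * n))" and "b' = \<phi> f (P (- (q * n)))"
    have ab: "dist a' a = L" "dist b' b = L"
      using close[of n] close[of "- n"] by (simp_all add: a_def b_def a'_def b'_def)
    have "K + 2 * \<delta> + 1 \<le> gromov_product ?w a' a" "K + 2 * \<delta> + 1 \<le> gromov_product ?w b' b"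
      using gromov_product_near[of ?w a' a] gromov_product_near[of ?w b' b] ab far fd
      by (simp_all add: a'_def b'_def)
    moreover have "gromov_product ?w a' b' \<le> K"
      using gromov_product_act[OF f, of x "P (q * n)" "P (- (q * n))"] gromov_product_opposite[of "q * n"]
      by (simp add: a'_def b'_def P0)
    \<comment> \<open>Replacing \<open>a'\<close> by \<open>a\<close> and then \<open>b'\<close> by
      \<open>b\<close> costs \<open>\<delta>\<close> each time.\<close>
    ultimately have "gromov_product ?w a b \<le> K + 2 * \<delta>"
      using gromov_ineq[of ?w a' a b'] gromov_ineq[of ?w a b b'] delta_nonneg gromov_product_commute[of ?w b' b]
      by (simp add: min_def split: if_splits)
    then obtain j where "dist ?w (P j) \<le> K + (K + 2 * \<delta>) + len 1 + 2 * \<delta>"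
      using near_point_opposite[of ?w "p * n" "K + 2 * \<delta>"] unfolding a_def b_def by blast
    then show ?thesis by blast
  qed
  then show ?thesis unfolding P_def by blast
qed

text \<open>With positive exponents \<open>f\<close> maps \<open>P m\<close> near some
  \<open>P n\<close> on the same side of the axis. A small displacement at \<open>x\<close> makes
  \<open>len m\<close> and \<open>len n\<close> close, so \<open>f\<close> almost fixes
  \<open>P m\<close> and acylindricity applies. The suitable \<open>m\<close> depends on
  \<open>f\<close>, hence the passage to finite subsets \<open>T\<close> and a common
  \<open>m\<close>.\<close>

lemma finite_commensurator_positive:
  assumes lox: "loxodromic G \<phi> h"
  shows "finite {f \<in> carrier G. dist x (\<phi> f x) \<le> D \<and>
    (\<exists>p>0. \<exists>q>0. f \<otimes> h [^] (q::int) = h [^] (p::int) \<otimes> f)}" (is "finite ?S")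
proof -
  have h: "h \<in> carrier G" using lox loxodromic_carrier by blast
  define P where "P n = \<phi> (h [^] n) x" for n :: int
  obtain c C where "quasi_axis \<delta> P c C" using loxodromic_quasi_axis[OF lox] unfolding P_def by blast
  then interpret quasi_axis X \<delta> P c C .
  have P0: "P 0 = x" by (simp add: P_def)
  define e where "e = 3 * \<bar>D\<bar> + 2 * K"
  have moves: "dist (P m) (\<phi> f (P m)) \<le> e"
    if f: "f \<in> carrier G" "dist x (\<phi> f x) \<le> D" "f \<otimes> h [^] m = h [^] n \<otimes> f" "0 \<le> m" "0 \<le> n" for f and m n :: int
  proof -
    have eq: "\<phi> f (P m) = \<phi> (h [^] n) (\<phi> f x)"
      using f h by (simp add: P_def act_mult[symmetric])
    then have close: "dist (P n) (\<phi> f (P m)) \<le> D" using f h by (simp add: P_def)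
    have "len m = dist (\<phi> f x) (\<phi> f (P m))" using f(1) by (simp add: len_def P0)
    then have "\<bar>len m - len n\<bar> \<le> 2 * D"
      using f(2) close dist_triangle[of "\<phi> f x" "\<phi> f (P m)" x] dist_triangle[of x "\<phi> f (P m)" "P n"]
        dist_triangle[of x "P n" "\<phi> f x"] dist_triangle[of "\<phi> f x" "P n" "\<phi> f (P m)"]
      by (simp add: len_def P0 dist_commute abs_le_iff)
    then show ?thesis
      using close dist_P_le[OF f(4,5)] dist_triangle[of "P m" "\<phi> f (P m)" "P n"] by (simp add: e_def)
  qed
  obtain R N where RN: "\<forall>x y T. R \<le> dist x y \<longrightarrow> T \<subseteq> carrier G \<longrightarrow>
       (\<forall>g\<in>T. dist x (\<phi> g x) \<le> e \<and> dist y (\<phi> g y) \<le> e) \<longrightarrow> finite T \<and> card T \<le> (N :: nat)"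
    using acylindrical_card by blast
  obtain m0 where m0: "\<And>n. m0 \<le> n \<Longrightarrow> R \<le> len n" using len_at_top by blast
  have "card T \<le> N" if T: "T \<subseteq> ?S" "finite T" for T
  proof -
    have "\<forall>f\<in>T. \<exists>p q. p > 0 \<and> q > 0 \<and> f \<otimes> h [^] (q::int) = h [^] (p::int) \<otimes> f" using T by blast
    then obtain p q where pq: "\<And>f. f \<in> T \<Longrightarrow> p f > 0 \<and> q f > 0 \<and> f \<otimes> h [^] (q f :: int) = h [^] (p f :: int) \<otimes> f"
      by metis
    \<comment> \<open>A common multiple of all \<open>q f\<close>, large enough that
      \<open>P r\<close> is at distance at least \<open>R\<close> from \<open>x\<close>.\<close>
    define r where "r = prod q T * max 1 m0"
    have "0 < prod q T" using pq by (intro prod_pos) blast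
    then have r: "0 < r" "m0 \<le> r" by (auto simp: r_def max_def mult_le_cancel_right1)
    have "dist x (\<phi> f x) \<le> e \<and> dist (P r) (\<phi> f (P r)) \<le> e" if "f \<in> T" for f
    proof -
      have f: "f \<in> carrier G" "dist x (\<phi> f x) \<le> D" using that T by auto
      have "q f dvd r" using that T by (simp add: r_def dvd_prodI)
      then obtain k where k: "r = q f * k" by blast
      then have "0 < k" using r pq[OF that] by (simp add: zero_less_mult_iff)
      have "f \<otimes> h [^] r = h [^] (p f * k) \<otimes> f"
        unfolding k using intertwine_pow_mult f h pq[OF that] by blast
      then have "dist (P r) (\<phi> f (P r)) \<le> e"
        using moves[OF f] r(1) pq[OF that] \<open>0 < k\<close> by (simp add: less_imp_le)
      moreover have "dist x (\<phi> f x) \<le> e" using f(2) K(1) by (simp add: e_def)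
      ultimately show ?thesis by blast
    qed
    then show ?thesis using RN[rule_format, of x "P r" T] T m0[OF r(2)] by (auto simp: len_def P0)
  qed
  then show ?thesis using finite_if_finite_subsets_card_bdd[of ?S N] by blast
qed

text \<open>After \<open>q\<close> is made positive, the sign of \<open>p\<close> tells, for
  loxodromic \<open>h\<close>, whether \<open>f\<close> preserves or exchanges the two ends of the
  axis.\<close>

lemma commensuratorE:
  assumes "f \<in> commensurator h" "h \<in> carrier G"
  obtains "\<exists>p>0. \<exists>q>0. f \<otimes> h [^] (q::int) = h [^] (p::int) \<otimes> f"
    | "\<exists>p>0. \<exists>q>0. f \<otimes> h [^] (q::int) = h [^] (- p::int) \<otimes> f"
proof -
  obtain p q :: int where f: "f \<in> carrier G" "p \<noteq> 0" "q \<noteq> 0" "f \<otimes> h [^] q = h [^] p \<otimes> f"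
    using assms(1) unfolding commensurator_def by blast
  have eq: "f \<otimes> h [^] \<bar>q\<bar> = h [^] (p * sgn q) \<otimes> f"
    using intertwine_pow_mult[OF f(1) assms(2) f(4), of "sgn q"] by (simp add: abs_sgn)
  have "\<bar>q\<bar> > 0" using f by simp
  moreover have "p * sgn q > 0 \<or> - (p * sgn q) > 0" using f by (auto simp: sgn_if)
  ultimately show ?thesis using that eq by (metis minus_minus)
qed

text \<open>Right multiplication by one fixed element exchanging the ends injects the elements of
  that kind into those preserving the ends, with displacement at most \<open>2 * D\<close>.\<close>

lemma finite_commensurator_bounded:
  assumes lox: "loxodromic G \<phi> h"
  shows "finite {f \<in> commensurator h. dist x (\<phi> f x) \<le> D}"
proof -
  have h: "h \<in> carrier G" using lox loxodromic_carrier by blast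
  let ?pos = "\<lambda>D. {f \<in> carrier G. dist x (\<phi> f x) \<le> D \<and>
    (\<exists>p>0. \<exists>q>0. f \<otimes> h [^] (q::int) = h [^] (p::int) \<otimes> f)}"
  let ?neg = "{f \<in> carrier G. dist x (\<phi> f x) \<le> D \<and>
    (\<exists>p>0. \<exists>q>0. f \<otimes> h [^] (q::int) = h [^] (- p::int) \<otimes> f)}"
  have "finite ?neg"
  proof (cases "?neg = {}")
    case True
    then show ?thesis by (simp only: finite.emptyI)
  next
    case False
    then obtain f0 and p0 q0 :: int where f0: "f0 \<in> carrier G" "dist x (\<phi> f0 x) \<le> D" "p0 > 0" "q0 > 0"
      "f0 \<otimes> h [^] (q0::int) = h [^] (- p0::int) \<otimes> f0" by blast
    have "f \<otimes> f0 \<in> ?pos (2 * D)" if fn: "f \<in> ?neg" for f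
    proof -
      obtain p q :: int where f: "f \<in> carrier G" "dist x (\<phi> f x) \<le> D" "p > 0" "q > 0"
        "f \<otimes> h [^] (q::int) = h [^] (- p::int) \<otimes> f" using fn by blast
      have "(f \<otimes> f0) \<otimes> h [^] (q0 * q) = f \<otimes> (h [^] (- p0 * q) \<otimes> f0)"
        using intertwine_pow_mult[OF f0(1) h f0(5), of q] f(1) f0(1) h by (simp add: m_assoc)
      also have "\<dots> = h [^] (- p * - p0) \<otimes> (f \<otimes> f0)"
        using intertwine_pow_mult[OF f(1) h f(5), of "- p0"] f(1) f0(1) h
        by (simp add: m_assoc[symmetric] mult.commute)
      finally have "(f \<otimes> f0) \<otimes> h [^] (q0 * q) = h [^] (p * p0) \<otimes> (f \<otimes> f0)" by simp
      moreover have "q0 * q > 0" "p * p0 > 0" using f f0 by simp_all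
      moreover have "dist x (\<phi> (f \<otimes> f0) x) \<le> 2 * D"
        using dist_triangle[of x "\<phi> f (\<phi> f0 x)" "\<phi> f x"] f f0 by (simp add: act_mult)
      ultimately show ?thesis using f(1) f0(1) by blast
    qed
    then have "(\<lambda>f. f \<otimes> f0) ` ?neg \<subseteq> ?pos (2 * D)" by blast
    then have "finite ((\<lambda>f. f \<otimes> f0) ` ?neg)"
      using finite_commensurator_positive[OF lox] finite_subset by blast
    moreover have "inj_on (\<lambda>f. f \<otimes> f0) ?neg" using f0(1) by (auto intro!: inj_onI)
    ultimately show ?thesis by (rule finite_imageD)
  qed
  moreover have "{f \<in> commensurator h. dist x (\<phi> f x) \<le> D} \<subseteq> ?pos D \<union> ?neg"
    using commensuratorE[OF _ h] unfolding commensurator_def by blast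
  ultimately show ?thesis using finite_commensurator_positive[OF lox] by (meson finite_UnI finite_subset)
qed

text \<open>A power of \<open>h\<close> brings \<open>\<phi> f x\<close> back to within a uniform
  distance of \<open>x\<close>, where only finitely many elements of the commensurator remain. Thus
  \<open>F\<close> represents all right cosets of the cyclic group generated by \<open>h\<close> in
  its commensurator.\<close>

lemma commensurator_finite_index:
  assumes lox: "loxodromic G \<phi> h"
  shows "\<exists>F\<subseteq>carrier G. finite F \<and> (\<forall>f\<in>commensurator h. \<exists>j. h [^] (j::int) \<otimes> f \<in> F)"
proof -
  have h: "h \<in> carrier G" using lox loxodromic_carrier by blast
  fix x
  obtain D where D: "\<And>f. f \<in> commensurator h \<Longrightarrow> \<exists>j. dist (\<phi> f x) (\<phi> (h [^] (j::int)) x) \<le> D"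
    using commensurator_near_axis[OF lox, of x] by blast
  have "\<exists>j. h [^] (j::int) \<otimes> f \<in> {f \<in> commensurator h. dist x (\<phi> f x) \<le> D}" if fc: "f \<in> commensurator h" for f
  proof -
    obtain j :: int where j: "dist (\<phi> f x) (\<phi> (h [^] (j::int)) x) \<le> D" using D fc by blast
    obtain p q :: int where f: "f \<in> carrier G" "p \<noteq> 0" "q \<noteq> 0" "f \<otimes> h [^] (q::int) = h [^] (p::int) \<otimes> f"
      using fc unfolding commensurator_def by blast
    have "(h [^] (- j) \<otimes> f) \<otimes> h [^] q = h [^] (- j) \<otimes> h [^] p \<otimes> f"
      using f h by (simp add: m_assoc)
    also have "\<dots> = h [^] p \<otimes> (h [^] (- j) \<otimes> f)"
      using f h by (simp add: m_assoc[symmetric] int_pow_mult[symmetric] add.commute)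
    finally have "h [^] (- j) \<otimes> f \<in> commensurator h"
      using f h unfolding commensurator_def by blast
    moreover have "dist x (\<phi> (h [^] (- j) \<otimes> f) x) \<le> D"
      using j dist_inv_mult[of "h [^] j" f x x] f h by (simp add: int_pow_neg dist_commute)
    ultimately show ?thesis by blast
  qed
  then show ?thesis
    using finite_commensurator_bounded[OF lox, of x D]
    by (intro exI[of _ "{f \<in> commensurator h. dist x (\<phi> f x) \<le> D}"]) (auto simp: commensurator_def)
qed

lemma virtually_cyclic_if_commensurator:
  assumes lox: "loxodromic G \<phi> g" and "carrier G \<subseteq> commensurator g"
  shows "virtually_cyclic G"
proof -
  have g: "g \<in> carrier G" using lox loxodromic_carrier by blast
  define H where "H = range (\<lambda>n::int. g [^] n)"
  have "H = generate G {g}" using generate_pow[OF g] by (auto simp: H_def)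
  then have sub: "subgroup H G" using generate_is_subgroup[of "{g}"] g by simp
  then have "cyclic_group (G\<lparr>carrier := H\<rparr>)"
  proof -
    interpret H: group "G\<lparr>carrier := H\<rparr>" using sub by (rule subgroup_imp_group)
    have "g \<in> H" unfolding H_def using g by (intro range_eqI[of _ _ 1]) simp
    then have "H = range (\<lambda>n::int. g [^]\<^bsub>G\<lparr>carrier := H\<rparr>\<^esub> n)"
      by (subst (1) H_def) (simp add: int_pow_consistent[OF sub])
    then show ?thesis unfolding H.cyclic_group using \<open>g \<in> H\<close> by auto
  qed
  moreover have "finite (rcosets H)"
  proof -
    obtain F where F: "F \<subseteq> carrier G" "finite F" "\<And>f. f \<in> carrier G \<Longrightarrow> \<exists>j. g [^] (j::int) \<otimes> f \<in> F"
      using commensurator_finite_index[OF lox] assms(2) by blast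
    have "rcosets H \<subseteq> (\<lambda>f. H #> f) ` F"
    proof
      fix c assume "c \<in> rcosets H"
      then obtain f where f: "f \<in> carrier G" "c = H #> f" by (auto simp: RCOSETS_def)
      then obtain j where j: "g [^] (j::int) \<otimes> f \<in> F" using F by blast
      have "g [^] j \<otimes> f \<in> H #> f" by (auto simp: r_coset_def H_def)
      then have "c = H #> (g [^] j \<otimes> f)" using repr_independence[OF _ f(1) sub] f(2) by simp
      then show "c \<in> (\<lambda>f. H #> f) ` F" using j by blast
    qed
    then show ?thesis using F(2) finite_surj by blast
  qed
  ultimately show ?thesis using sub unfolding virtually_cyclic_def by blast
qed

text \<open>All powers of \<open>g [^] k\<close> lie in the commensurator of \<open>h\<close>;
  modulo left multiplication by powers of \<open>h\<close> there are only finitely many classes, so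
  two distinct powers share one.\<close>

lemma common_power_if_pow_in_commensurator:
  assumes g: "loxodromic G \<phi> g" and h: "loxodromic G \<phi> h"
    and k: "k \<noteq> 0" "g [^] (k::int) \<in> commensurator h"
  shows "\<exists>m n. m \<noteq> 0 \<and> n \<noteq> 0 \<and> g [^] (m::int) = h [^] (n::int)"
proof -
  have gh: "g \<in> carrier G" "h \<in> carrier G" using g h loxodromic_carrier by blast+
  define u where "u = g [^] k"
  have u: "u \<in> carrier G" using gh by (simp add: u_def)
  obtain p q where pq: "p \<noteq> 0" "q \<noteq> 0" "u \<otimes> h [^] (q::int) = h [^] (p::int) \<otimes> u"
    using k unfolding commensurator_def u_def by blast
  \<comment> \<open>Conjugation by \<open>u\<close> turns the exponent \<open>q\<close> into
    \<open>p\<close>, so iterating it raises both to the power \<open>i\<close>.\<close>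
  have pow: "u [^] i \<otimes> h [^] (q ^ i) = h [^] (p ^ i) \<otimes> u [^] i" for i :: nat
  proof (induction i)
    case (Suc i)
    have "u [^] Suc i \<otimes> h [^] (q ^ Suc i) = u [^] i \<otimes> (u \<otimes> h [^] (q * q ^ i))"
      using u gh by (simp add: m_assoc)
    also have "\<dots> = u [^] i \<otimes> h [^] (q ^ i * p) \<otimes> u"
      using intertwine_pow_mult[OF u gh(2) pq(3), of "q ^ i"] u gh by (simp add: m_assoc mult.commute)
    also have "\<dots> = h [^] (p ^ Suc i) \<otimes> u [^] Suc i"
      using intertwine_pow_mult[OF _ gh(2) Suc, of p] u gh by (simp add: m_assoc mult.commute)
    finally show ?case .
  qed (use gh u in simp)
  have "u [^] i \<in> commensurator h" for i :: nat
    using pow[of i] pq u unfolding commensurator_def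
    by (intro CollectI conjI exI[of _ "p ^ i"] exI[of _ "q ^ i"]) simp_all
  moreover obtain F where F: "finite F" "\<And>f. f \<in> commensurator h \<Longrightarrow> \<exists>j. h [^] (j::int) \<otimes> f \<in> F"
    using commensurator_finite_index[OF h] by blast
  ultimately have "\<forall>i::nat. \<exists>j. h [^] (j::int) \<otimes> u [^] i \<in> F" by blast
  then obtain j where j: "\<And>i::nat. h [^] (j i :: int) \<otimes> u [^] i \<in> F" by metis
  have "finite (range (\<lambda>i. h [^] j i \<otimes> u [^] i))"
    using F(1) by (rule finite_subset[rotated]) (use j in blast)
  then have "\<not> inj (\<lambda>i. h [^] j i \<otimes> u [^] i)" using finite_imageD infinite_UNIV_nat by blast
  then obtain i i' where ii: "i \<noteq> i'" "h [^] j i \<otimes> u [^] i = h [^] j i' \<otimes> u [^] i'" by (auto simp: inj_def)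
  have "g [^] (k * int i - k * int i') = h [^] (j i' - j i)"
    using ii gh by (intro int_pow_quotient_eq) (simp_all add: u_def int_pow_pow[symmetric] int_pow_int)
  moreover have "k * int i - k * int i' \<noteq> 0" using ii k by simp
  ultimately show ?thesis using loxodromic_pow_neq_one[OF g] by (metis int_pow_0)
qed

end

section \<open>Independence\<close>

lemma products_divergeD:
  assumes "products_diverge x y"
  obtains N where "\<And>i j. N \<le> i \<Longrightarrow> N \<le> j \<Longrightarrow> M \<le> gromov_product s (x i) (y j)"
proof -
  have "eventually (\<lambda>(i, j). M \<le> gromov_product s (x i) (y j)) (sequentially \<times>\<^sub>F sequentially)"
    using assms unfolding products_diverge_def filterlim_at_top by (simp add: case_prod_unfold)
  then obtain N where "\<And>i j. N \<le> i \<Longrightarrow> N \<le> j \<Longrightarrow> M \<le> gromov_product s (x i) (y j)"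
    unfolding eventually_prod_sequentially by auto
  then show ?thesis by (rule that)
qed

section \<open>Convergence of half-orbits at infinity\<close>

context quasi_axis
begin

text \<open>For \<open>i \<le> j\<close> the product of \<open>P i\<close> and \<open>P j\<close> at
  \<open>P 0\<close> is \<open>len i\<close> minus their complementary product at
  \<open>P i\<close>, which is at most \<open>K\<close>.\<close>

lemma converges_at_infinity: "converges_at_infinity (\<lambda>n. P (int n))"
proof -
  have *: "len i - K \<le> gromov_product (P 0) (P i) (P j)" if "0 \<le> i" "i \<le> j" for i j
    using gromov_product_add[of "P 0" "P i" "P j"] K(2)[OF that] by (simp add: len_def)
  have "\<exists>N. \<forall>j\<ge>N. \<forall>i\<ge>N. M \<le> gromov_product s (P (int i)) (P (int j))" for s M
  proof -
    obtain n0 where n0: "\<And>n. n0 \<le> n \<Longrightarrow> M + K + dist s (P 0) \<le> len n" using len_at_top by blast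
    have "M \<le> gromov_product s (P (int i)) (P (int j))" if "nat n0 \<le> i" "nat n0 \<le> j" for i j
    proof -
      have "M + dist s (P 0) \<le> gromov_product (P 0) (P (int i)) (P (int j))"
      proof (cases "i \<le> j")
        case True
        then show ?thesis using *[of "int i" "int j"] n0[of "int i"] that by (simp add: nat_le_iff)
      next
        case False
        then show ?thesis
          using *[of "int j" "int i"] n0[of "int j"] that gromov_product_commute[of "P 0" "P (int i)"]
          by (simp add: nat_le_iff)
      qed
      then show ?thesis
        using gromov_product_base_change[of "P 0" "P (int i)" "P (int j)" s] by (simp add: dist_commute)
    qed
    then show ?thesis by blast
  qed
  then show ?thesis
    unfolding converges_at_infinity_def products_diverge_def filterlim_at_top
    by (auto simp: eventually_prod_sequentially)
qed

end

section \<open>Common limit points and common powers\<close>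

context acylindrical_hyperbolic_action
begin

text \<open>A representative \<open>y\<close> of the common limit point links the two orbits, whose
  mutual products are therefore unbounded. The exponents have arbitrary signs, so replacing
  \<open>g\<close> or \<open>h\<close> by its inverse may be necessary before
  \<open>common_power_of_divergence\<close> applies.\<close>

lemma common_power_if_common_limit_point:
  assumes lox: "loxodromic G \<phi> g" "loxodromic G \<phi> h"
    and "limit_points G \<phi> g \<inter> limit_points G \<phi> h \<noteq> {}"
  shows "\<exists>m n. m \<noteq> 0 \<and> n \<noteq> 0 \<and> g [^] (m::int) = h [^] (n::int)"
proof -
  have g: "g \<in> carrier G" and h: "h \<in> carrier G" using lox loxodromic_carrier by blast+
  obtain \<xi> x s and k l :: "nat \<Rightarrow> int" where
    "converges_to_boundary (\<lambda>n. \<phi> (g [^] k n) x) \<xi>" "converges_to_boundary (\<lambda>n. \<phi> (h [^] l n) s) \<xi>"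
    using assms(3) unfolding limit_points_def by blast
  then obtain y where y: "products_diverge y (\<lambda>n. \<phi> (g [^] k n) x)" "products_diverge y (\<lambda>n. \<phi> (h [^] l n) s)"
    unfolding converges_to_boundary_def gromov_boundary_def quotient_def boundary_rel_def by blast
  have div: "\<exists>k l. M \<le> gromov_product x (\<phi> (g [^] (k::int)) x) (\<phi> (h [^] (l::int)) x)" for M
  proof -
    let ?M = "M + \<delta> + dist s x"
    obtain N1 where N1: "\<And>i j. N1 \<le> i \<Longrightarrow> N1 \<le> j \<Longrightarrow> ?M \<le> gromov_product x (y i) (\<phi> (g [^] k j) x)"
      using products_divergeD[OF y(1)] by blast
    obtain N2 where N2: "\<And>i j. N2 \<le> i \<Longrightarrow> N2 \<le> j \<Longrightarrow> ?M \<le> gromov_product x (y i) (\<phi> (h [^] l j) s)"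
      using products_divergeD[OF y(2)] by blast
    define n where "n = max N1 N2"
    let ?a = "\<phi> (g [^] k n) x" and ?b = "\<phi> (h [^] l n) s" and ?b' = "\<phi> (h [^] l n) x"
    have "?M \<le> gromov_product x ?a (y n)" "?M \<le> gromov_product x (y n) ?b"
      using N1[of n n] N2[of n n] by (simp_all add: n_def gromov_product_commute)
    then have "M + dist s x \<le> gromov_product x ?a ?b"
      using gromov_ineq[of x ?a "y n" ?b] by linarith
    then have "M \<le> gromov_product x ?a ?b'"
      using gromov_product_perturb[of x ?a ?b x ?a ?b'] h by simp
    then show ?thesis by blast
  qed
  \<comment> \<open>If the products were bounded for each of the four sign patterns, the largest of
    the four bounds would contradict \<open>div\<close>.\<close>
  define S :: "int set" where "S = {1, - 1}"
  have "\<exists>\<sigma>\<in>S. \<exists>\<tau>\<in>S. \<forall>M. \<exists>k\<ge>0. \<exists>l\<ge>0.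
      M \<le> gromov_product x (\<phi> (g [^] (\<sigma> * k :: int)) x) (\<phi> (h [^] (\<tau> * l :: int)) x)"
  proof (rule ccontr)
    assume "\<not> ?thesis"
    then have "\<forall>\<sigma>\<in>S. \<forall>\<tau>\<in>S. \<exists>M. \<forall>k\<ge>0. \<forall>l\<ge>0.
      \<not> M \<le> gromov_product x (\<phi> (g [^] (\<sigma> * k :: int)) x) (\<phi> (h [^] (\<tau> * l :: int)) x)"
      by blast
    then obtain B where B: "\<And>\<sigma> \<tau> k l. \<sigma> \<in> S \<Longrightarrow> \<tau> \<in> S \<Longrightarrow> 0 \<le> k \<Longrightarrow> 0 \<le> l \<Longrightarrow>
      \<not> B \<sigma> \<tau> \<le> gromov_product x (\<phi> (g [^] (\<sigma> * k :: int)) x) (\<phi> (h [^] (\<tau> * l :: int)) x)"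
      by metis
    define M where "M = Max (case_prod B ` (S \<times> S))"
    obtain k l where kl: "M \<le> gromov_product x (\<phi> (g [^] (k::int)) x) (\<phi> (h [^] (l::int)) x)" using div by blast
    define \<sigma> \<tau> :: int where "\<sigma> = (if 0 \<le> k then 1 else - 1)" and "\<tau> = (if 0 \<le> l then 1 else - 1)"
    have st: "\<sigma> \<in> S" "\<tau> \<in> S" "\<sigma> * \<bar>k\<bar> = k" "\<tau> * \<bar>l\<bar> = l"
      by (auto simp: \<sigma>_def \<tau>_def S_def)
    have "B \<sigma> \<tau> \<le> M" unfolding M_def using st(1,2)
      by (intro Max_ge) (auto simp: S_def intro!: image_eqI[of _ _ "(\<sigma>, \<tau>)"])
    then show False using B[OF st(1,2), of "\<bar>k\<bar>" "\<bar>l\<bar>"] kl st(3,4) by simp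
  qed
  then obtain \<sigma> \<tau> :: int where st: "\<sigma> \<noteq> 0" "\<tau> \<noteq> 0" and
    div': "\<And>M. \<exists>k\<ge>0. \<exists>l\<ge>0. M \<le> gromov_product x (\<phi> (g [^] (\<sigma> * k :: int)) x) (\<phi> (h [^] (\<tau> * l :: int)) x)"
    by (metis S_def insertE singletonD zero_neq_one zero_neq_neg_one)
  have "\<exists>m n. m \<noteq> 0 \<and> n \<noteq> 0 \<and> (g [^] \<sigma>) [^] (m::int) = (h [^] \<tau>) [^] (n::int)"
    using common_power_of_divergence[OF loxodromic_pow[OF lox(1) st(1)] loxodromic_pow[OF lox(2) st(2)], of x] div' g h
    by (simp add: int_pow_pow)
  then show ?thesis using g h st by (metis int_pow_pow mult_eq_0_iff)
qed

text \<open>The half-orbit of the common power is a sequence of orbit points for both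
  \<open>g\<close> and \<open>h\<close>, and it converges at infinity.\<close>

lemma common_limit_point_if_common_power:
  assumes lox: "loxodromic G \<phi> g" "loxodromic G \<phi> h"
    and mn: "m \<noteq> 0" "g [^] (m::int) = h [^] (n::int)"
  shows "limit_points G \<phi> g \<inter> limit_points G \<phi> h \<noteq> {}"
proof -
  have g: "g \<in> carrier G" and h: "h \<in> carrier G" using lox loxodromic_carrier by blast+
  fix x
  obtain c C where "quasi_axis \<delta> (\<lambda>k. \<phi> ((g [^] m) [^] (k::int)) x) c C"
    using loxodromic_quasi_axis[OF loxodromic_pow[OF lox(1) mn(1)]] by blast
  then interpret quasi_axis X \<delta> "\<lambda>k. \<phi> ((g [^] m) [^] (k::int)) x" c C .
  define a where "a i = \<phi> ((g [^] m) [^] int i) x" for i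
  have "converges_at_infinity a" using converges_at_infinity unfolding a_def .
  then have "a \<in> Collect converges_at_infinity" "(a, a) \<in> boundary_rel"
    by (simp_all add: boundary_rel_def converges_at_infinity_def)
  then have xi: "converges_to_boundary a (boundary_rel `` {a})"
    unfolding converges_to_boundary_def gromov_boundary_def by (blast intro: quotientI)
  have ga: "a = (\<lambda>i. \<phi> (g [^] (m * int i)) x)"
    using g by (simp add: fun_eq_iff a_def int_pow_pow)
  have ha: "a = (\<lambda>i. \<phi> (h [^] (n * int i)) x)"
    using h by (simp add: fun_eq_iff a_def mn(2) int_pow_pow)
  have "boundary_rel `` {a} \<in> limit_points G \<phi> g"
    unfolding limit_points_def
    by (intro CollectI exI[of _ x] exI[of _ "\<lambda>i. m * int i"]) (fold ga, rule xi)
  moreover have "boundary_rel `` {a} \<in> limit_points G \<phi> h"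
    unfolding limit_points_def
    by (intro CollectI exI[of _ x] exI[of _ "\<lambda>i. n * int i"]) (fold ha, rule xi)
  ultimately show ?thesis by blast
qed

text \<open>By the pigeonhole principle on cosets, a nontrivial power of each loxodromic element
  lies in the cyclic subgroup generated by \<open>t\<close>, and two nonzero powers of
  \<open>t\<close> have a common multiple exponent.\<close>

lemma virtually_cyclic_common_power:
  assumes "virtually_cyclic G" and lox: "loxodromic G \<phi> g" "loxodromic G \<phi> h"
  shows "\<exists>m n. m \<noteq> 0 \<and> n \<noteq> 0 \<and> g [^] (m::int) = h [^] (n::int)"
proof -
  obtain H where sub: "subgroup H G" and cyc: "cyclic_group (G\<lparr>carrier := H\<rparr>)" and fin: "finite (rcosets H)"
    using assms(1) unfolding virtually_cyclic_def by blast
  interpret H: group "G\<lparr>carrier := H\<rparr>" using sub by (rule subgroup_imp_group)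
  obtain t where t: "t \<in> H" "H = range (\<lambda>n::int. t [^]\<^bsub>G\<lparr>carrier := H\<rparr>\<^esub> n)"
    using cyc unfolding H.cyclic_group by auto
  have tG: "t \<in> carrier G" using t(1) sub subgroup.mem_carrier by metis
  have H: "H = range (\<lambda>n::int. t [^] n)"
    using t(2) by (simp add: int_pow_consistent[OF sub t(1)])
  have pow: "\<exists>m a. m \<noteq> 0 \<and> a \<noteq> 0 \<and> f [^] (m::int) = t [^] (a::int)" if f: "loxodromic G \<phi> f" for f
  proof -
    have fG: "f \<in> carrier G" using f loxodromic_carrier by blast
    have "range (\<lambda>i. H #> f [^] int i) \<subseteq> rcosets H" using fG by (auto simp: RCOSETS_def)
    then have "\<not> inj (\<lambda>i. H #> f [^] int i)"
      using fin finite_subset finite_imageD infinite_UNIV_nat by metis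
    then obtain i i' where ii: "i \<noteq> i'" "H #> f [^] int i = H #> f [^] int i'" by (auto simp: inj_def)
    have "f [^] int i \<in> H #> f [^] int i'" using rcos_self[OF _ sub, of "f [^] int i"] fG ii(2) by simp
    then obtain a where "f [^] int i = t [^] (a::int) \<otimes> f [^] int i'" unfolding r_coset_def H by auto
    then have "t [^] (0::int) \<otimes> f [^] int i = t [^] a \<otimes> f [^] int i'" using fG tG by simp
    then have "f [^] (int i - int i') = t [^] (a - 0)" by (intro int_pow_quotient_eq fG tG)
    moreover have "int i - int i' \<noteq> 0" using ii by simp
    ultimately show ?thesis using loxodromic_pow_neq_one[OF f, of "int i - int i'"] by (metis int_pow_0)
  qed
  obtain m a where ma: "m \<noteq> 0" "a \<noteq> 0" "g [^] (m::int) = t [^] (a::int)" using pow[OF lox(1)] by blast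
  obtain n b where nb: "n \<noteq> 0" "b \<noteq> 0" "h [^] (n::int) = t [^] (b::int)" using pow[OF lox(2)] by blast
  have "g [^] (m * b) = h [^] (n * a)"
    using ma(3) nb(3) tG loxodromic_carrier[OF lox(1)] loxodromic_carrier[OF lox(2)]
    by (simp add: int_pow_pow[symmetric]) (simp add: int_pow_pow mult.commute)
  then show ?thesis using ma nb by (metis mult_eq_0_iff)
qed

lemma virtually_cyclic_not_infinite_independent:
  assumes "virtually_cyclic G" "infinite L" "\<forall>g\<in>L. loxodromic G \<phi> g"
  shows "\<not> pairwise (independent_loxodromics G \<phi>) L"
proof
  assume pw: "pairwise (independent_loxodromics G \<phi>) L"
  obtain g where g: "g \<in> L" using assms(2) by fastforce
  obtain h where h: "h \<in> L" "h \<noteq> g" using assms(2) g by (metis finite.simps insertI1 subsetI subset_singleton_iff)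
  have lox: "loxodromic G \<phi> g" "loxodromic G \<phi> h" using g h assms(3) by blast+
  obtain m n where "m \<noteq> 0" "g [^] (m::int) = h [^] (n::int)"
    using virtually_cyclic_common_power[OF assms(1) lox] by blast
  then have "limit_points G \<phi> g \<inter> limit_points G \<phi> h \<noteq> {}"
    by (rule common_limit_point_if_common_power[OF lox])
  then show False using pw g h unfolding pairwise_def independent_loxodromics_def by blast
qed

text \<open>If \<open>f\<close> does not commensurate \<open>g\<close>, its conjugate
  \<open>h\<close> shares no power with \<open>g\<close>. A common power of two of the conjugates
  \<open>r n\<close> would put a nonzero power of \<open>g\<close> into the commensurator of
  \<open>h\<close>, and so produce a common power of \<open>g\<close> and \<open>h\<close>.\<close>

lemma virtually_cyclic_or_infinite_independent:
  assumes lox: "loxodromic G \<phi> g"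
  shows "virtually_cyclic G \<or> (\<exists>L\<subseteq>carrier G. infinite L \<and> (\<forall>g\<in>L. loxodromic G \<phi> g) \<and>
            pairwise (independent_loxodromics G \<phi>) L)"
proof (cases "carrier G \<subseteq> commensurator g")
  case True
  then show ?thesis using virtually_cyclic_if_commensurator[OF lox] by blast
next
  case False
  then obtain f where f: "f \<in> carrier G" "f \<notin> commensurator g" by blast
  have g: "g \<in> carrier G" using lox loxodromic_carrier by blast
  define h where "h = f \<otimes> g \<otimes> inv f"
  have h: "h \<in> carrier G" using f g by (simp add: h_def)
  have hlox: "loxodromic G \<phi> h" unfolding h_def using loxodromic_conj lox f(1) by blast
  have no_gh: "\<not> (\<exists>m n. m \<noteq> 0 \<and> n \<noteq> 0 \<and> g [^] (m::int) = h [^] (n::int))"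
  proof safe
    fix m n :: int assume mn: "m \<noteq> 0" "n \<noteq> 0" "g [^] m = h [^] n"
    then have "g [^] m = f \<otimes> g [^] n \<otimes> inv f" using int_pow_conj[OF f(1) g] by (simp add: h_def)
    then have "f \<otimes> g [^] n = g [^] m \<otimes> f" using f(1) g by (simp add: m_assoc)
    then show False using f mn unfolding commensurator_def by blast
  qed
  define r where "r n = g [^] int n \<otimes> h \<otimes> inv (g [^] int n)" for n
  have rlox: "loxodromic G \<phi> (r n)" for n unfolding r_def using loxodromic_conj[OF hlox] g by blast
  have no_rr: "\<not> (\<exists>p q. p \<noteq> 0 \<and> q \<noteq> 0 \<and> r m [^] (p::int) = r n [^] (q::int))" if "m \<noteq> n" for m n
  proof safe
    fix p q :: int assume pq: "p \<noteq> 0" "q \<noteq> 0" "r m [^] p = r n [^] q"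
    let ?a = "g [^] int m" and ?b = "g [^] int n"
    have ab: "?a \<in> carrier G" "?b \<in> carrier G" using g by auto
    have eq: "?a \<otimes> h [^] p \<otimes> inv ?a = ?b \<otimes> h [^] q \<otimes> inv ?b"
      using pq(3) int_pow_conj[OF ab(1) h] int_pow_conj[OF ab(2) h] by (simp add: r_def)
    have "inv ?b \<otimes> ?a \<otimes> h [^] p = inv ?b \<otimes> (?a \<otimes> h [^] p \<otimes> inv ?a) \<otimes> ?a"
      using ab h by (simp add: m_assoc)
    also have "\<dots> = h [^] q \<otimes> (inv ?b \<otimes> ?a)"
      unfolding eq using ab h by (simp add: m_assoc[symmetric])
    also have "inv ?b \<otimes> ?a = g [^] (int m - int n)"
      using g by (simp add: int_pow_neg[symmetric] int_pow_mult[symmetric])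
    finally have "g [^] (int m - int n) \<in> commensurator h"
      using pq(1,2) g unfolding commensurator_def by blast
    then show False
      using common_power_if_pow_in_commensurator[OF lox hlox, of "int m - int n"] that no_gh by simp
  qed
  have "inj r"
  proof (rule injI, rule ccontr)
    fix m n assume "r m = r n" "m \<noteq> n"
    then show False using no_rr[of m n] by (metis zero_neq_one)
  qed
  then have "infinite (range r)" using finite_imageD infinite_UNIV_nat by blast
  moreover have "independent_loxodromics G \<phi> (r m) (r n)" if "m \<noteq> n" for m n
    using common_power_if_common_limit_point[OF rlox rlox, of m n] no_rr[OF that] rlox[of m] rlox[of n]
    unfolding independent_loxodromics_def by blast
  then have "pairwise (independent_loxodromics G \<phi>) (range r)" by (intro pairwise_imageI)
  moreover have "range r \<subseteq> carrier G" using rlox loxodromic_carrier by blast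
  ultimately show ?thesis using rlox by (metis rangeE)
qed

end

section \<open>Existence of loxodromic elements\<close>

context hyperbolic_action
begin

text \<open>Otherwise \<open>loxodromic_mult\<close> with both factors equal to \<open>g\<close>
  would make \<open>g \<otimes> g\<close> loxodromic.\<close>

lemma displacement_square_le:
  assumes "\<And>g. \<not> loxodromic G \<phi> g" "g \<in> carrier G"
  shows "dist x (\<phi> (g \<otimes> g) x) \<le> dist x (\<phi> g x) + 2 * \<delta> + 1"
  using loxodromic_mult[of g g x] assms by (force simp: not_le)

text \<open>Two orbit points far from \<open>x\<close> lie in nearly the same direction, since otherwise
  \<open>loxodromic_mult\<close> makes \<open>g \<otimes> h\<close> loxodromic.\<close>

lemma gromov_product_orbit_ge:
  assumes no: "\<And>g. \<not> loxodromic G \<phi> g" and g: "g \<in> carrier G" and h: "h \<in> carrier G"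
  shows "min (dist x (\<phi> g x)) (dist x (\<phi> h x)) / 2 - (2 * \<delta> + 1) \<le> gromov_product x (\<phi> g x) (\<phi> h x)"
proof (rule ccontr)
  let ?gx = "\<phi> g x" and ?hx = "\<phi> h x" and ?gi = "\<phi> (inv g) x" and ?hi = "\<phi> (inv h) x"
  assume "\<not> ?thesis"
  then have small: "2 * gromov_product x ?gx ?hx < min (dist x ?gx) (dist x ?hx) - (4 * \<delta> + 2)"
    by (simp add: not_le)
  have d: "dist x ?gi = dist x ?gx" "dist x ?hi = dist x ?hx"
    using g h by (simp_all add: dist_inv dist_commute)
  have di: "dist ?gi ?gx = dist x (\<phi> (g \<otimes> g) x)" "dist ?hi ?hx = dist x (\<phi> (h \<otimes> h) x)"
    "dist ?gi ?hx = dist x (\<phi> (g \<otimes> h) x)" "dist ?hi ?gx = dist x (\<phi> (h \<otimes> g) x)"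
    using g h dist_inv_mult[of "inv g" g x x] dist_inv_mult[of "inv h" h x x]
      dist_inv_mult[of "inv g" h x x] dist_inv_mult[of "inv h" g x x] by simp_all
  note double = gromov_product_double
  \<comment> \<open>Since \<open>g \<otimes> g\<close> moves \<open>x\<close> little more than
    \<open>g\<close> does, \<open>?gi\<close> lies in the direction of \<open>?gx\<close>. So a
    small product of \<open>?gx\<close> and \<open>?hx\<close> is inherited by \<open>?gi\<close>
    and \<open>?hx\<close>, whose distance is the displacement of \<open>g \<otimes> h\<close>;
    \<open>hh\<close> plays the same role for \<open>h \<otimes> g\<close>.\<close>
  have gg: "dist x ?gx - (2 * \<delta> + 1) \<le> 2 * gromov_product x ?gx ?gi"
    using displacement_square_le[OF no g, of x] unfolding double d by (simp add: dist_commute[of ?gx] di)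
  have hh: "dist x ?hx - (2 * \<delta> + 1) \<le> 2 * gromov_product x ?hx ?hi"
    using displacement_square_le[OF no h, of x] unfolding double d by (simp add: dist_commute[of ?hx] di)
  have "gromov_product x ?gi ?hx \<le> gromov_product x ?gx ?hx + \<delta>"
    using gromov_ineq[of x ?gx ?gi ?hx] gg small delta_nonneg by (simp add: min_def split: if_splits)
  then have gh: "max (dist x ?gx) (dist x ?hx) + 2 * \<delta> + 1 \<le> dist x (\<phi> (g \<otimes> h) x)"
    using small double[of x ?gi ?hx] unfolding d di by (auto simp: max_def min_def split: if_splits)
  have "gromov_product x ?hi ?gx \<le> gromov_product x ?gx ?hx + \<delta>"
    using gromov_ineq[of x ?hx ?hi ?gx] hh small delta_nonneg
    by (simp add: min_def gromov_product_commute[of x ?hx ?gx] split: if_splits)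
  then have hg: "max (dist x ?gx) (dist x ?hx) + 2 * \<delta> + 1 \<le> dist x (\<phi> (h \<otimes> g) x)"
    using small double[of x ?hi ?gx] unfolding d di by (auto simp: max_def min_def split: if_splits)
  show False using loxodromic_mult[OF g h gh hg] no by blast
qed

text \<open>On a geodesic from \<open>x\<close> to \<open>p\<close> whose direction is almost fixed by \<open>g\<close>, the isometry \<open>g\<close> acts
  far from both ends as an approximate translation by the Busemann shift \<open>\<beta>\<close>. If \<open>g\<close> is not
  loxodromic then \<open>2 * \<bar>\<beta>\<bar>\<close>, the shift of \<open>g \<otimes> g\<close>, exceeds \<open>\<bar>\<beta>\<bar>\<close> by a bounded amount only.\<close>

lemma displacement_on_geodesic_le:
  assumes geo: "geodesic_space TYPE('s)" and g: "g \<in> carrier G"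
    and sq: "\<And>y. dist y (\<phi> (g \<otimes> g) y) \<le> dist y (\<phi> g y) + 2 * \<delta> + 1"
    and M: "dist x (\<phi> g x) \<le> M" and B: "B \<le> gromov_product x p (\<phi> g p)"
    and z: "dist x z + dist z p = dist x p"
    and t: "3 * M + 10 * \<delta> + 10 \<le> dist x z" "dist x z + M \<le> B"
  shows "dist z (\<phi> g z) \<le> 32 * \<delta> + 1"
proof -
  have M0: "0 \<le> M" using M zero_le_dist order_trans by blast
  have dn: "0 \<le> \<delta>" by (rule delta_nonneg)
  define q where "q = \<phi> (inv g) x"
  have q: "dist x q \<le> M" "dist q y = dist x (\<phi> g y)" for y
    using M g dist_inv[of g x x] dist_inv[of "inv g" x y] by (simp_all add: q_def dist_commute)
  \<comment> \<open>As \<open>dist q y = dist x (\<phi> g y)\<close>, the change of the distance to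
    \<open>x\<close> under \<open>g\<close> is \<open>dist x q\<close> minus twice the product of
    \<open>q\<close> and \<open>y\<close>. Along the geodesic beyond \<open>M\<close> that product
    differs from the one with \<open>p\<close> by at most \<open>\<delta>\<close>.\<close>
  define \<beta> where "\<beta> = dist x q - 2 * gromov_product x q p"
  have on_geodesic: "gromov_product x y p = dist x y" if "dist x y + dist y p = dist x p" for y
    using that by (simp add: gromov_product_def dist_commute)
  have shift: "\<bar>dist x (\<phi> g y) - dist x y - \<beta>\<bar> \<le> 2 * \<delta>"
    if y: "dist x y + dist y p = dist x p" "M \<le> dist x y" for y
  proof -
    have "gromov_product x q y \<le> M" "gromov_product x q p \<le> M"
      using gromov_product_le_dist[of x q] q(1) order_trans by blast+
    then have "\<bar>gromov_product x q y - gromov_product x q p\<bar> \<le> \<delta>"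
      using gromov_ineq[of x q y p] gromov_ineq[of x q p y] on_geodesic[OF y(1)] y(2)
        gromov_product_commute[of x y p] by (auto simp: abs_le_iff min_def split: if_splits)
    moreover have "dist x (\<phi> g y) = dist x q + dist x y - 2 * gromov_product x q y"
      using gromov_product_double[of x q y] q(2) by simp
    ultimately show ?thesis unfolding \<beta>_def by (auto simp: abs_le_iff)
  qed
  let ?u = "\<phi> g z" and ?x = "\<phi> g x" and ?p = "\<phi> g p"
  define s where "s = dist x ?u"
  have s: "dist x z - M \<le> s" "s \<le> dist x z + M"
    using M dist_triangle[of x ?u ?x] dist_triangle[of ?x ?u x] g
    by (simp_all add: s_def dist_commute[of ?x x])
  \<comment> \<open>The image \<open>?u\<close> lies between \<open>?x\<close> and
    \<open>?p\<close>, hence almost between \<open>x\<close> and \<open>?p\<close>. Up to distance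
    \<open>B\<close> the directions of \<open>?p\<close> and \<open>p\<close> agree, so
    \<open>?u\<close> is near the point \<open>w\<close> of the geodesic at the same distance
    \<open>s\<close> from \<open>x\<close>.\<close>
  have "gromov_product ?u ?x ?p = 0" using gromov_product_act[OF g, of z x p] z by (simp add: gromov_product_def dist_commute)
  moreover have "s - M \<le> gromov_product ?u ?x x"
    using gromov_product_near[of ?u x ?x] M gromov_product_commute[of ?u x ?x] by (simp add: s_def dist_commute)
  ultimately have "gromov_product ?u x ?p \<le> \<delta>"
    using gromov_ineq[of ?u ?x x ?p] s t dn M0 by (simp add: min_def split: if_splits)
  then have "s - \<delta> \<le> gromov_product x ?u ?p"
    using gromov_product_add[of x ?u ?p] by (simp add: s_def)
  moreover have "s \<le> gromov_product x ?p p" using B s(2) t(2) gromov_product_commute[of x p ?p] by simp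
  ultimately have u: "s - 2 * \<delta> \<le> gromov_product x ?u p"
    using gromov_ineq[of x ?u ?p p] dn by (simp add: min_def split: if_splits)
  have "s \<le> dist x p" using B s(2) t(2) gromov_product_le_dist[of x p ?p] by simp
  then obtain w where w: "dist x w = s" "dist w p = dist x p - s"
    using geodesic_space_point_at[OF geo, of s x p] by (auto simp: s_def)
  then have wp: "dist x w + dist w p = dist x p" by simp
  have "s - 3 * \<delta> \<le> gromov_product x ?u w"
    using gromov_ineq[of x ?u p w] on_geodesic[OF wp] gromov_product_commute[of x p w] u w(1) dn
    by (simp add: min_def split: if_splits)
  then have uw: "dist ?u w \<le> 6 * \<delta>"
    using gromov_product_double[of x ?u w] w(1) by (simp add: s_def)
  have "min (dist x z) s - \<delta> \<le> gromov_product x z w"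
    using gromov_ineq[of x z p w] on_geodesic[OF wp] on_geodesic[OF z] gromov_product_commute[of x p w] w(1)
    by simp
  then have "dist z w \<le> \<bar>s - dist x z\<bar> + 2 * \<delta>"
    using gromov_product_double[of x z w] w(1) by (auto simp: min_def abs_if split: if_splits)
  moreover have sb: "\<bar>s - dist x z - \<beta>\<bar> \<le> 2 * \<delta>" using shift[OF z] t M0 dn by (simp add: s_def)
  moreover have "dist z ?u \<le> dist z w + dist ?u w" by metric
  ultimately have zu: "dist z ?u \<le> \<bar>\<beta>\<bar> + 10 * \<delta>" using uw by (auto simp: abs_if split: if_splits)
  \<comment> \<open>A second application of \<open>g\<close>, now at \<open>w\<close>, accumulates
    the shift \<open>2 * \<beta>\<close>.\<close>
  have "\<bar>dist x (\<phi> g w) - s - \<beta>\<bar> \<le> 2 * \<delta>" using shift[OF wp] w(1) s(1) t M0 dn by simp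
  then have "2 * \<bar>\<beta>\<bar> - 4 * \<delta> \<le> \<bar>dist x (\<phi> g w) - dist x z\<bar>"
    using sb by (auto simp: abs_if split: if_splits)
  also have "\<dots> \<le> dist z (\<phi> g w)"
    using dist_triangle[of x "\<phi> g w" z] dist_triangle[of x z "\<phi> g w"] by (simp add: abs_le_iff dist_commute)
  also have "\<dots> \<le> dist z (\<phi> (g \<otimes> g) z) + dist (\<phi> g ?u) (\<phi> g w)"
    using g dist_triangle[of z "\<phi> g w" "\<phi> g ?u"] by (simp add: act_mult)
  also have "\<dots> \<le> dist z ?u + 2 * \<delta> + 1 + 6 * \<delta>" using sq[of z] uw g by simp
  \<comment> \<open>The estimates give \<open>\<bar>\<beta>\<bar> \<le> 22 * \<delta> + 1\<close>,
    and \<open>zu\<close> adds \<open>10 * \<delta>\<close>.\<close>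
  finally show ?thesis using zu by linarith
qed

end

section \<open>From unbounded orbits to loxodromic elements\<close>

context acylindrical_hyperbolic_action
begin

lemma exists_loxodromic_if_unbounded:
  assumes geo: "geodesic_space TYPE('s)" and unb: "\<not> bounded (orbit G \<phi> x)"
  shows "\<exists>g\<in>carrier G. loxodromic G \<phi> g"
proof (rule ccontr)
  assume "\<not> ?thesis"
  then have no: "\<not> loxodromic G \<phi> g" for g using loxodromic_carrier by blast
  have "infinite (carrier G)"
  proof
    assume "finite (carrier G)"
    then have "finite (orbit G \<phi> x)" unfolding orbit_def by simp
    then show False using unb finite_imp_bounded by blast
  qed
  obtain R N where RN: "\<forall>x y T. R \<le> dist x y \<longrightarrow> T \<subseteq> carrier G \<longrightarrow>
       (\<forall>g\<in>T. dist x (\<phi> g x) \<le> 32 * \<delta> + 1 \<and> dist y (\<phi> g y) \<le> 32 * \<delta> + 1) \<longrightarrow> finite T \<and> card T \<le> (N :: nat)"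
    using acylindrical_card by blast
  obtain T where T: "T \<subseteq> carrier G" "finite T" "card T = Suc N"
    using infinite_arbitrarily_large[OF \<open>infinite (carrier G)\<close>] by blast
  define M where "M = Max (insert 0 ((\<lambda>g. dist x (\<phi> g x)) ` T))"
  have M: "0 \<le> M" "\<And>g. g \<in> T \<Longrightarrow> dist x (\<phi> g x) \<le> M" using T(2) by (auto simp: M_def)
  \<comment> \<open>Between \<open>t0\<close> and \<open>t1\<close> the hypotheses of
    \<open>displacement_on_geodesic_le\<close> hold for every element of \<open>T\<close>, and the
    window is wide enough for two points at distance at least \<open>R\<close>.\<close>
  define t0 t1 B where "t0 = 3 * M + 10 * \<delta> + 10" and "t1 = t0 + \<bar>R\<bar>" and "B = t1 + M"
  \<comment> \<open>The summand \<open>M\<close> keeps \<open>g \<otimes> h\<close> far enough for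
    every \<open>g\<close> in \<open>T\<close>; half the remaining distance minus
    \<open>2 * \<delta> + 1\<close> is \<open>B\<close>.\<close>
  obtain h where h: "h \<in> carrier G" "2 * (B + 2 * \<delta> + 1) + M \<le> dist x (\<phi> h x)"
  proof (rule ccontr)
    assume "\<not> thesis"
    then have "\<forall>y\<in>orbit G \<phi> x. dist x y \<le> 2 * (B + 2 * \<delta> + 1) + M"
      using that unfolding orbit_def by (force simp: not_le intro: less_imp_le)
    then show False using unb unfolding bounded_any_center[of _ x] by blast
  qed
  let ?p = "\<phi> h x"
  have pos: "0 \<le> t0" "t0 \<le> t1" "t1 + M \<le> B" "B \<le> dist x ?p"
    using M(1) delta_nonneg h(2) by (auto simp: t0_def t1_def B_def)
  obtain z0 where z0: "dist x z0 = t0" "dist z0 ?p = dist x ?p - t0"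
    using geodesic_space_point_at[OF geo, of t0 x ?p] pos M(1) by auto
  obtain z1 where z1: "dist x z1 = t1" "dist z1 ?p = dist x ?p - t1"
    using geodesic_space_point_at[OF geo, of t1 x ?p] pos M(1) by auto
  have "R \<le> dist z0 z1" using dist_triangle[of x z1 z0] z0(1) z1(1) by (simp add: t1_def)
  moreover have "dist z0 (\<phi> g z0) \<le> 32 * \<delta> + 1 \<and> dist z1 (\<phi> g z1) \<le> 32 * \<delta> + 1" if "g \<in> T" for g
  proof -
    have g: "g \<in> carrier G" "dist x (\<phi> g x) \<le> M" using that T M by auto
    have "dist x ?p - M \<le> dist x (\<phi> g ?p)"
      using dist_triangle[of "\<phi> g x" "\<phi> g ?p" x] g
      by (simp add: dist_commute)
    then have B: "B \<le> gromov_product x ?p (\<phi> g ?p)"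
      using gromov_product_orbit_ge[OF no h(1), of "g \<otimes> h" x] g(1) h M(1)
      by (simp add: act_mult min_def split: if_splits)
    show ?thesis
      using displacement_on_geodesic_le[OF geo g(1) displacement_square_le[OF no g(1)] g(2) B, of z0]
        displacement_on_geodesic_le[OF geo g(1) displacement_square_le[OF no g(1)] g(2) B, of z1]
        z0 z1 pos by (simp add: t0_def t1_def)
  qed
  ultimately show False using RN[rule_format, of z0 z1 T] T by auto
qed

lemma loxodromic_not_bounded_orbits:
  assumes "loxodromic G \<phi> g"
  shows "\<not> bounded_orbits G \<phi>"
proof
  fix x
  assume "bounded_orbits G \<phi>"
  then obtain B where B: "\<And>y. y \<in> orbit G \<phi> x \<Longrightarrow> dist x y \<le> B"
    unfolding bounded_orbits_def bounded_any_center[of _ x] by metis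
  have g: "g \<in> carrier G" using assms by (rule loxodromic_carrier)
  obtain c C where "quasi_axis \<delta> (\<lambda>k. \<phi> (g [^] (k::int)) x) c C"
    using loxodromic_quasi_axis[OF assms] by blast
  then interpret quasi_axis X \<delta> "\<lambda>k. \<phi> (g [^] (k::int)) x" c C .
  obtain n where "B + 1 \<le> len n" using len_at_top[of "B + 1"] by blast
  moreover have "dist x (\<phi> (g [^] n) x) \<le> B" using g by (intro B) (auto simp: orbit_def)
  ultimately show False by (simp add: len_def)
qed

end

theorem theorem1p1:
  fixes G :: "('g, 'm) monoid_scheme"
    and \<phi> :: "'g \<Rightarrow> 's::metric_space \<Rightarrow> 's"
  assumes "group G"
    and "hyperbolic_space TYPE('s)"
    and "acylindrical_action G \<phi>"
  shows "let a = bounded_orbits G \<phi>;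
             b = (virtually_cyclic G \<and> (\<exists>g\<in>carrier G. loxodromic G \<phi> g));
             c = (\<exists>L\<subseteq>carrier G. infinite L \<and> (\<forall>g\<in>L. loxodromic G \<phi> g) \<and>
                    pairwise (independent_loxodromics G \<phi>) L)
         in (a \<or> b \<or> c) \<and> \<not> (a \<and> b) \<and> \<not> (a \<and> c) \<and> \<not> (b \<and> c)"
proof -
  obtain \<delta> where "gromov_hyperbolic TYPE('s) \<delta>"
    using hyperbolic_space_gromov_hyperbolic[OF assms(2)] by blast
  then interpret acylindrical_hyperbolic_action "TYPE('s)" \<delta> G \<phi>
    using assms(1,3)
    by (simp add: acylindrical_hyperbolic_action_def hyperbolic_action_def
        acylindrical_hyperbolic_action_axioms_def hyperbolic_action_axioms_def acylindrical_action_def)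
  have "geodesic_space TYPE('s)" using assms(2) by (simp add: hyperbolic_space_def)
  then have "bounded_orbits G \<phi> \<or> (\<exists>g\<in>carrier G. loxodromic G \<phi> g)"
    unfolding bounded_orbits_def using exists_loxodromic_if_unbounded by blast
  moreover have "\<not> bounded_orbits G \<phi>" if "infinite L" "\<forall>g\<in>L. loxodromic G \<phi> g" for L
    using that loxodromic_not_bounded_orbits by (metis finite.emptyI ex_in_conv)
  ultimately show ?thesis
    unfolding Let_def
    using virtually_cyclic_or_infinite_independent loxodromic_not_bounded_orbits
      virtually_cyclic_not_infinite_independent by blast
qed

end
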